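(* For every integer $d\ge 1$ let $s_d>0$ be the unique solution $s\in(0,\infty)$ of $\frac{x_0^2}{2s^2}=\log\!\left(\frac{d\,s}{\sqrt{2\pi}\,\epsilon\,x_0}\right)$ with $\epsilon=1/8$ and $x_0=1/8$, and let $\mu_d,\nu_d$ be the probability measures on $\mathbb{R}^d$ with densities $\rho_d^+,\rho_d^-$ (defined in the context) for the standard deviation $s=s_d$. Let $\kappa=\sup_{x\in\mathbb{R}}|\cos(x)\sin(2x)|=0.7698\ldots$. Then there is a constant $C>0$, independent of $d$, such that for all $d\ge 1$ $$d_{\mathcal{F}_{2L}}(\mu_d,\nu_d)\le C\,\kappa^d d^2,$$ and for all $d\ge 1$ $$d_{\mathcal{F}_{3L}}(\mu_d,\nu_d)\ \ge\ \frac{1}{513\,d^2+512\,d+1}.$$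
   Context: Activation: $\sigma(x)=\max\{x,0\}$ (ReLU). Measures: $\mathcal{B}=\{-\tfrac32,-\tfrac12,\tfrac12,\tfrac32\}$, $\mathcal{B}^d_+=\{x\in\mathcal{B}^d:\prod_{i=1}^d x_i>0\}$, $\mathcal{B}^d_-=\{x\in\mathcal{B}^d:\prod_{i=1}^d x_i<0\}$. For $s>0$, $\mu_d,\nu_d$ are the probability measures on $\mathbb{R}^d$ with densities $$\rho_d^{\pm}(x)=\frac{2}{(4\sqrt{2\pi s^2})^d}\sum_{\beta\in\mathcal{B}^d_\pm}\exp\!\left(-\frac{\|x-\beta\|^2}{2s^2}\right)$$ ($\rho_d^+$ for $\mu_d$, $\rho_d^-$ for $\nu_d$). Integral probability metric: for a class $\mathcal{F}$ of functions $\mathbb{R}^d\to\mathbb{R}$, $d_{\mathcal{F}}(\mu,\nu)=\sup_{f\in\mathcal{F}}\left|\mathbb{E}_{x\sim\mu}f(x)-\mathbb{E}_{x\sim\nu}f(x)\right|$. $\mathcal{F}_{3L}$: the set of functions of the form (any finite widths $m_1,m_2$) $$f(x)=\sum_{i=1}^{m_2}w_i\,\sigma\Big(\sum_{j=1}^{m_1}W_{i,j}\,\sigma(\langle\theta_j,x\rangle-b_j)+W_{i,0}\Big)+w_0,$$ with $\theta_j\in\mathbb{R}^d$ and all other parameters real, whose path-norm with bias $\sum_{i=1}^{m_2}|w_i|\big(\sum_{j=1}^{m_1}|W_{i,j}|\,\|(\theta_j,b_j)\|_2+|W_{i,0}|\big)+|w_0|$ is at most $1$. $\mathcal{F}_{2L}$: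 the set of functions of the form (any finite width $m$) $f(x)=\sum_{i=1}^m w_i\,\sigma(\langle\theta_i,x\rangle-b_i)+w_0$ with $\theta_i\in\mathbb{R}^d$, $b_i,w_i,w_0\in\mathbb{R}$, whose path-norm without bias $\sum_{i=1}^m|w_i|\,\|\theta_i\|_2$ is at most $1$. For this class, $d_{\mathcal{F}_{2L}}(\mu,\nu)=\sup_{(\theta,b)\in\mathbb{S}^{d-1}\times\mathbb{R}}\left|\int\sigma(\langle\theta,x\rangle-b)\,d(\mu-\nu)(x)\right|$. *)

theory Defs
  imports "HOL-Probability.Probability"
begin

text \<open>
  The dimension \<open>d\<close> is quantified inside the statement, so \<open>\<real>\<^sup>d\<close> is the space of the product
  measure \<open>\<Pi>\<^sub>M i\<in>{1..d}. lborel\<close>: points are functions \<open>x :: nat \<Rightarrow> real\<close> with coordinates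
  \<open>x 1, \<dots>, x d\<close>, and the Euclidean norm is \<open>L2_set x {1..d}\<close>.
\<close>

definition leb :: "nat \<Rightarrow> (nat \<Rightarrow> real) measure" where
  "leb d = (\<Pi>\<^sub>M i\<in>{1..d}. lborel)"

definition enorm :: "nat \<Rightarrow> (nat \<Rightarrow> real) \<Rightarrow> real" where
  "enorm d x = L2_set x {1..d}"

definition dot :: "nat \<Rightarrow> (nat \<Rightarrow> real) \<Rightarrow> (nat \<Rightarrow> real) \<Rightarrow> real" where
  "dot d x y = (\<Sum>i=1..d. x i * y i)"

definition relu :: "real \<Rightarrow> real" where
  "relu x = max x 0"

definition B :: "real set" where
  "B = {-3/2, -1/2, 1/2, 3/2}"

definition B_pos :: "nat \<Rightarrow> (nat \<Rightarrow> real) set" where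
  "B_pos d = {x \<in> {1..d} \<rightarrow>\<^sub>E B. (\<Prod>i=1..d. x i) > 0}"

definition B_neg :: "nat \<Rightarrow> (nat \<Rightarrow> real) set" where
  "B_neg d = {x \<in> {1..d} \<rightarrow>\<^sub>E B. (\<Prod>i=1..d. x i) < 0}"

definition mixture_density :: "nat \<Rightarrow> real \<Rightarrow> (nat \<Rightarrow> real) set \<Rightarrow> (nat \<Rightarrow> real) \<Rightarrow> real" where
  "mixture_density d s S x =
     2 / (4 * sqrt (2 * pi * s\<^sup>2)) ^ d *
     (\<Sum>\<beta>\<in>S. exp (- ((enorm d (\<lambda>i. x i - \<beta> i))\<^sup>2 / (2 * s\<^sup>2))))"

definition mu :: "nat \<Rightarrow> real \<Rightarrow> (nat \<Rightarrow> real) measure" where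
  "mu d s = density (leb d) (\<lambda>x. ennreal (mixture_density d s (B_pos d) x))"

definition nu :: "nat \<Rightarrow> real \<Rightarrow> (nat \<Rightarrow> real) measure" where
  "nu d s = density (leb d) (\<lambda>x. ennreal (mixture_density d s (B_neg d) x))"

text \<open>The supremum is taken in \<open>ereal\<close>, so that it is meaningful without a prior bound.\<close>

definition ipm :: "('a \<Rightarrow> real) set \<Rightarrow> 'a measure \<Rightarrow> 'a measure \<Rightarrow> ereal" where
  "ipm F M N = (SUP f\<in>F. ereal \<bar>integral\<^sup>L M f - integral\<^sup>L N f\<bar>)"

definition net3 :: "nat \<Rightarrow> nat \<Rightarrow> nat \<Rightarrow> (nat \<Rightarrow> nat \<Rightarrow> real) \<Rightarrow> (nat \<Rightarrow> real) \<Rightarrow>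
    (nat \<Rightarrow> nat \<Rightarrow> real) \<Rightarrow> (nat \<Rightarrow> real) \<Rightarrow> (nat \<Rightarrow> real) \<Rightarrow> real" where
  "net3 d m1 m2 \<theta> b W w x =
     (\<Sum>i=1..m2. w i * relu ((\<Sum>j=1..m1. W i j * relu (dot d (\<theta> j) x - b j)) + W i 0)) + w 0"

definition path_norm3 :: "nat \<Rightarrow> nat \<Rightarrow> nat \<Rightarrow> (nat \<Rightarrow> nat \<Rightarrow> real) \<Rightarrow> (nat \<Rightarrow> real) \<Rightarrow>
    (nat \<Rightarrow> nat \<Rightarrow> real) \<Rightarrow> (nat \<Rightarrow> real) \<Rightarrow> real" where
  "path_norm3 d m1 m2 \<theta> b W w =
     (\<Sum>i=1..m2. \<bar>w i\<bar> *
        ((\<Sum>j=1..m1. \<bar>W i j\<bar> * sqrt ((enorm d (\<theta> j))\<^sup>2 + (b j)\<^sup>2)) + \<bar>W i 0\<bar>)) + \<bar>w 0\<bar>"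

definition F3L :: "nat \<Rightarrow> ((nat \<Rightarrow> real) \<Rightarrow> real) set" where
  "F3L d = {net3 d m1 m2 \<theta> b W w | m1 m2 \<theta> b W w. path_norm3 d m1 m2 \<theta> b W w \<le> 1}"

definition net2 :: "nat \<Rightarrow> nat \<Rightarrow> (nat \<Rightarrow> nat \<Rightarrow> real) \<Rightarrow> (nat \<Rightarrow> real) \<Rightarrow> (nat \<Rightarrow> real) \<Rightarrow>
    (nat \<Rightarrow> real) \<Rightarrow> real" where
  "net2 d m \<theta> b w x = (\<Sum>i=1..m. w i * relu (dot d (\<theta> i) x - b i)) + w 0"

definition path_norm2 :: "nat \<Rightarrow> nat \<Rightarrow> (nat \<Rightarrow> nat \<Rightarrow> real) \<Rightarrow> (nat \<Rightarrow> real) \<Rightarrow> real" where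
  "path_norm2 d m \<theta> w = (\<Sum>i=1..m. \<bar>w i\<bar> * enorm d (\<theta> i))"

definition F2L :: "nat \<Rightarrow> ((nat \<Rightarrow> real) \<Rightarrow> real) set" where
  "F2L d = {net2 d m \<theta> b w | m \<theta> b w. path_norm2 d m \<theta> w \<le> 1}"

definition sd_eq :: "real \<Rightarrow> real \<Rightarrow> nat \<Rightarrow> real \<Rightarrow> bool" where
  "sd_eq \<epsilon> x\<^sub>0 d s \<longleftrightarrow> x\<^sub>0\<^sup>2 / (2 * s\<^sup>2) = ln (real d * s / (sqrt (2 * pi) * \<epsilon> * x\<^sub>0))"

definition sd :: "nat \<Rightarrow> real" where
  "sd d = (THE s. s > 0 \<and> sd_eq (1/8) (1/8) d s)"

definition kappa :: real where
  "kappa = (SUP x::real. \<bar>cos x * sin (2 * x)\<bar>)"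

end

theory Submission
  imports Defs
begin

text \<open>
  Write \<open>p\<close> for the one-dimensional Gaussian mixture centred at \<open>B\<close> and \<open>q\<close> for the same mixture
  weighted with the signs of the centres. Then \<open>\<rho>\<^sup>+\<close> and \<open>\<rho>\<^sup>-\<close> are \<open>\<Prod>p(x\<^sub>i) \<plusminus> \<Prod>q(x\<^sub>i)\<close>, so that
  \<open>\<mu> - \<nu>\<close> has the product density \<open>2 \<Prod>q(x\<^sub>i)\<close>.

  Upper bound: \<open>\<bar>u\<bar>\<close> is a constant multiple of \<open>\<integral> (1 - cos (t u)) / t\<^sup>2 dt\<close>, so by Fubini the integral of
  a neuron is controlled by the Fourier transform of \<open>\<Prod>q(x\<^sub>i)\<close>, each factor of which has modulus
  \<open>exp (- s\<^sup>2 \<xi>\<^sup>2 / 2) \<bar>cos (\<xi>/2) sin \<xi>\<bar>\<close>. All factors but two are bounded by \<open>\<kappa>\<close>; the remaining two cancel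
  the singularity at \<open>t = 0\<close>. This costs a factor \<open>1 / s\<close>, which is \<open>O(d)\<close>. Since two factors are needed, \<open>d = 1\<close>
  is treated by the Lipschitz bound.

  Lower bound: the first layer computes soft indicators of \<open>x\<^sub>i < 0\<close>, the second a zigzag function
  of their sum which is \<open>(-1)\<^sup>j\<close> at \<open>j = 0, \<dots>, d\<close>. This network has path-norm at most \<open>24 d\<^sup>2 + 24 d + 1\<close>, and it
  equals the sign of \<open>\<Prod>x\<^sub>i\<close> whenever every \<open>\<bar>x\<^sub>i\<bar> \<ge> 1/4\<close>. The equation for \<open>s\<close> makes the Mills bound for
  the tail of one coordinate equal to \<open>1 / (4 d)\<close>, and the expectations then differ by at least \<open>1/2\<close>.
\<close>

section \<open>The densities\<close>

definition mixd :: "real \<Rightarrow> real \<Rightarrow> real" where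
  "mixd s x = (\<Sum>\<beta>\<in>B. normal_density \<beta> s x) / 4"

definition sgnd :: "real \<Rightarrow> real \<Rightarrow> real" where
  "sgnd s x = (\<Sum>\<beta>\<in>B. sgn \<beta> * normal_density \<beta> s x) / 4"

definition mixp :: "nat \<Rightarrow> real \<Rightarrow> (nat \<Rightarrow> real) \<Rightarrow> real" where
  "mixp d s x = (\<Prod>i=1..d. mixd s (x i))"

definition sgnp :: "nat \<Rightarrow> real \<Rightarrow> (nat \<Rightarrow> real) \<Rightarrow> real" where
  "sgnp d s x = (\<Prod>i=1..d. sgnd s (x i))"

lemma finite_B [simp]: "finite B"
  by (simp add: B_def)

lemma sum_B: "(\<Sum>\<beta>\<in>B. f \<beta>) = f (-3/2) + f (-1/2) + f (1/2) + f (3/2)" for f :: "real \<Rightarrow> 'a::comm_monoid_add"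
  by (simp add: B_def add.assoc)

lemma sgn_prod: "sgn (\<Prod>i\<in>A. f i) = (\<Prod>i\<in>A. sgn (f i))" for f :: "'a \<Rightarrow> real"
  by (induction A rule: infinite_finite_induct) (auto simp: sgn_mult)

lemma B_nonzero: "\<beta> \<in> B \<Longrightarrow> \<beta> \<noteq> 0"
  by (auto simp: B_def)

text \<open>The indicators of positive and negative products are \<open>(1 \<plusminus> \<Prod>\<^sub>i sgn \<beta>\<^sub>i) / 2\<close>.\<close>

lemma sum_sign_class:
  fixes g :: "(nat \<Rightarrow> real) \<Rightarrow> real"
  shows "2 * (\<Sum>\<beta>\<in>B_pos d. g \<beta>) = (\<Sum>\<beta>\<in>{1..d} \<rightarrow>\<^sub>E B. g \<beta>) + (\<Sum>\<beta>\<in>{1..d} \<rightarrow>\<^sub>E B. (\<Prod>i=1..d. sgn (\<beta> i)) * g \<beta>)"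
    and "2 * (\<Sum>\<beta>\<in>B_neg d. g \<beta>) = (\<Sum>\<beta>\<in>{1..d} \<rightarrow>\<^sub>E B. g \<beta>) - (\<Sum>\<beta>\<in>{1..d} \<rightarrow>\<^sub>E B. (\<Prod>i=1..d. sgn (\<beta> i)) * g \<beta>)"
proof -
  have fin: "finite ({1..d} \<rightarrow>\<^sub>E B)" by (intro finite_PiE) auto
  have nz: "(\<Prod>i=1..d. \<beta> i) \<noteq> 0" if "\<beta> \<in> {1..d} \<rightarrow>\<^sub>E B" for \<beta>
    using that by (auto simp: PiE_iff dest: B_nonzero)
  have "2 * (\<Sum>\<beta>\<in>B_pos d. g \<beta>) = (\<Sum>\<beta>\<in>{1..d} \<rightarrow>\<^sub>E B. 2 * (if (\<Prod>i=1..d. \<beta> i) > 0 then g \<beta> else 0))"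
    unfolding B_pos_def sum_distrib_left[symmetric] using fin by (subst sum.inter_filter) auto
  also have "\<dots> = (\<Sum>\<beta>\<in>{1..d} \<rightarrow>\<^sub>E B. g \<beta> + (\<Prod>i=1..d. sgn (\<beta> i)) * g \<beta>)"
    unfolding sgn_prod[symmetric] using nz by (intro sum.cong refl) (fastforce simp: sgn_if)
  finally show "2 * (\<Sum>\<beta>\<in>B_pos d. g \<beta>) = (\<Sum>\<beta>\<in>{1..d} \<rightarrow>\<^sub>E B. g \<beta>) + (\<Sum>\<beta>\<in>{1..d} \<rightarrow>\<^sub>E B. (\<Prod>i=1..d. sgn (\<beta> i)) * g \<beta>)"
    by (simp add: sum.distrib)
  have "2 * (\<Sum>\<beta>\<in>B_neg d. g \<beta>) = (\<Sum>\<beta>\<in>{1..d} \<rightarrow>\<^sub>E B. 2 * (if (\<Prod>i=1..d. \<beta> i) < 0 then g \<beta> else 0))"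
    unfolding B_neg_def sum_distrib_left[symmetric] using fin by (subst sum.inter_filter) auto
  also have "\<dots> = (\<Sum>\<beta>\<in>{1..d} \<rightarrow>\<^sub>E B. g \<beta> - (\<Prod>i=1..d. sgn (\<beta> i)) * g \<beta>)"
    unfolding sgn_prod[symmetric] using nz by (intro sum.cong refl) (fastforce simp: sgn_if)
  finally show "2 * (\<Sum>\<beta>\<in>B_neg d. g \<beta>) = (\<Sum>\<beta>\<in>{1..d} \<rightarrow>\<^sub>E B. g \<beta>) - (\<Sum>\<beta>\<in>{1..d} \<rightarrow>\<^sub>E B. (\<Prod>i=1..d. sgn (\<beta> i)) * g \<beta>)"
    by (simp add: sum_subtractf)
qed

text \<open>The squared norm is a sum over coordinates, so each bump factorises; the base
  \<open>4\<close> of the normalising power becomes the uniform weight \<open>1 / 4\<close> of the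
  four centres in every coordinate.\<close>

lemma exp_enorm_eq_prod_normal_density:
  "exp (- ((enorm d (\<lambda>i. x i - \<beta> i))\<^sup>2 / (2 * s\<^sup>2))) / (4 * sqrt (2 * pi * s\<^sup>2)) ^ d
    = (\<Prod>i=1..d. normal_density (\<beta> i) s (x i) / 4)"
proof -
  have "exp (- ((enorm d (\<lambda>i. x i - \<beta> i))\<^sup>2 / (2 * s\<^sup>2))) = (\<Prod>i=1..d. exp (- (x i - \<beta> i)\<^sup>2 / (2 * s\<^sup>2)))"
    by (simp add: enorm_def L2_set_def sum_nonneg exp_sum[symmetric] sum_negf sum_divide_distrib)
  moreover have "(4 * sqrt (2 * pi * s\<^sup>2)) ^ d = (\<Prod>i=1..d. 4 * sqrt (2 * pi * s\<^sup>2))"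
    by simp
  ultimately show ?thesis
    by (simp only: prod_dividef[symmetric]) (simp add: normal_density_def field_simps)
qed

text \<open>Distributing the products \<open>mixp\<close> and \<open>sgnp\<close> gives sums over
  the whole grid of centres, without and with the product of signs. The factor 2 of the density
  absorbs the halves in the sign indicators.\<close>

lemma mixture_density_eq:
  "mixture_density d s (B_pos d) x = mixp d s x + sgnp d s x"
  "mixture_density d s (B_neg d) x = mixp d s x - sgnp d s x"
proof -
  let ?g = "\<lambda>\<beta>. \<Prod>i=1..d. normal_density (\<beta> i) s (x i) / 4"
  have md: "mixture_density d s S x = 2 * (\<Sum>\<beta>\<in>S. ?g \<beta>)" for S
    unfolding mixture_density_def exp_enorm_eq_prod_normal_density[symmetric]
    by (simp add: sum_divide_distrib[symmetric])
  have p: "mixp d s x = (\<Sum>\<beta>\<in>{1..d} \<rightarrow>\<^sub>E B. ?g \<beta>)"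
    unfolding mixp_def mixd_def sum_divide_distrib by (subst prod_sum_PiE) auto
  have q: "sgnp d s x = (\<Sum>\<beta>\<in>{1..d} \<rightarrow>\<^sub>E B. (\<Prod>i=1..d. sgn (\<beta> i)) * ?g \<beta>)"
    unfolding sgnp_def sgnd_def sum_divide_distrib prod.distrib[symmetric] by (subst prod_sum_PiE) auto
  show "mixture_density d s (B_pos d) x = mixp d s x + sgnp d s x"
    "mixture_density d s (B_neg d) x = mixp d s x - sgnp d s x"
    unfolding md sum_sign_class p q by simp_all
qed

lemma mixd_measurable [measurable]: "mixd s \<in> borel_measurable borel"
  unfolding mixd_def by measurable

lemma sgnd_measurable [measurable]: "sgnd s \<in> borel_measurable borel"
  unfolding sgnd_def by measurable

lemma mixd_nonneg: "mixd s x \<ge> 0"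
  unfolding mixd_def by (intro divide_nonneg_nonneg sum_nonneg normal_density_nonneg) auto

lemma abs_sgnd_le: "\<bar>sgnd s x\<bar> \<le> mixd s x"
proof -
  have "\<bar>\<Sum>\<beta>\<in>B. sgn \<beta> * normal_density \<beta> s x\<bar> \<le> (\<Sum>\<beta>\<in>B. normal_density \<beta> s x)"
    by (rule order_trans[OF sum_abs]) (auto intro!: sum_mono simp: abs_mult sgn_if)
  then show ?thesis unfolding sgnd_def mixd_def by simp
qed

text \<open>This domination serves twice: it makes both densities nonnegative, and it carries
  integrability over from \<open>mixp\<close> to \<open>sgnp\<close>.\<close>

lemma abs_sgnp_le: "\<bar>sgnp d s x\<bar> \<le> mixp d s x"
  unfolding sgnp_def mixp_def abs_prod by (intro prod_mono conjI abs_sgnd_le) auto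

lemma sgnd_eq:
  "sgnd s x = (normal_density (1/2) s x + normal_density (3/2) s x
    - normal_density (-1/2) s x - normal_density (-3/2) s x) / 4"
  unfolding sgnd_def sum_B by simp

lemma mixd_eq:
  "mixd s x = (normal_density (1/2) s x + normal_density (3/2) s x
    + normal_density (-1/2) s x + normal_density (-3/2) s x) / 4"
  unfolding mixd_def sum_B by simp

context fixes s :: real assumes s: "s > 0"
begin

lemma mixd_integrable [simp]: "integrable lborel (mixd s)"
  using s unfolding mixd_def by auto

lemma sgnd_integrable [simp]: "integrable lborel (sgnd s)"
  using s unfolding sgnd_def by auto

lemma integral_mixd [simp]: "integral\<^sup>L lborel (mixd s) = 1"
  using s unfolding mixd_eq by (subst integral_divide_zero) auto

lemma integral_sgnd [simp]: "integral\<^sup>L lborel (sgnd s) = 0"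
  using s unfolding sgnd_eq by (subst integral_divide_zero) auto

lemma integrable_mixd_times_abs: "integrable lborel (\<lambda>x. \<bar>x\<bar> * mixd s x)"
proof -
  have 1: "integrable lborel (\<lambda>x. \<bar>x * normal_density \<mu> s x\<bar>)" for \<mu>
    using integrable_normal_moment_nz_1[OF s, of \<mu>] by (intro integrable_abs) (simp add: mult.commute)
  have "integrable lborel (\<lambda>x. (\<Sum>\<beta>\<in>B. \<bar>x * normal_density \<beta> s x\<bar>) / 4)"
    using 1 by auto
  then show ?thesis by (simp add: mixd_def abs_mult sum_distrib_left)
qed

end

section \<open>Integrals of product functions, and the measures \<open>mu\<close> and
  \<open>nu\<close>\<close>

lemma product_sigma_finite_lborel: "product_sigma_finite (\<lambda>_. lborel :: real measure)"
  by unfold_locales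

lemma leb_integrable_prod:
  fixes f :: "nat \<Rightarrow> real \<Rightarrow> 'a::{real_normed_field,banach,second_countable_topology}"
  assumes "\<And>i. i \<in> {1..d} \<Longrightarrow> integrable lborel (f i)"
  shows "integrable (leb d) (\<lambda>x. \<Prod>i=1..d. f i (x i))"
  unfolding leb_def
  using product_sigma_finite.product_integrable_prod[OF product_sigma_finite_lborel] assms by blast

lemma leb_integral_prod:
  fixes f :: "nat \<Rightarrow> real \<Rightarrow> 'a::{real_normed_field,banach,second_countable_topology}"
  assumes "\<And>i. i \<in> {1..d} \<Longrightarrow> integrable lborel (f i)"
  shows "(\<integral>x. (\<Prod>i=1..d. f i (x i)) \<partial>leb d) = (\<Prod>i=1..d. integral\<^sup>L lborel (f i))"
  unfolding leb_def
  using product_sigma_finite.product_integral_prod[OF product_sigma_finite_lborel] assms by blast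

lemma sigma_finite_leb: "sigma_finite_measure (leb d)"
  unfolding leb_def using product_sigma_finite.sigma_finite[OF product_sigma_finite_lborel] by blast

lemma dot_measurable [measurable]: "dot d \<theta> \<in> borel_measurable (leb d)"
  unfolding dot_def leb_def by measurable

lemma mixp_measurable [measurable]: "mixp d s \<in> borel_measurable (leb d)"
  unfolding mixp_def sgnp_def leb_def by measurable

lemma sgnp_measurable [measurable]: "sgnp d s \<in> borel_measurable (leb d)"
  unfolding mixp_def sgnp_def leb_def by measurable

lemma prob_space_mu_nu:
  assumes "s > 0" "d \<ge> 1"
  shows "prob_space (mu d s)" "prob_space (nu d s)"
proof -
  have ip: "integrable (leb d) (mixp d s)" "integral\<^sup>L (leb d) (mixp d s) = 1"
    unfolding mixp_def using assms leb_integrable_prod[of d "\<lambda>_. mixd s"] leb_integral_prod[of d "\<lambda>_. mixd s"] by simp_all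
  \<comment> \<open>The integral is \<open>0 ^ d\<close>, which vanishes for
    \<open>d \<ge> 1\<close>; the empty product would give 1.\<close>
  have iq: "integrable (leb d) (sgnp d s)" "integral\<^sup>L (leb d) (sgnp d s) = 0"
    unfolding sgnp_def using assms leb_integrable_prod[of d "\<lambda>_. sgnd s"] leb_integral_prod[of d "\<lambda>_. sgnd s"] by (simp_all add: power_0_left)
  have nn: "mixp d s x + sgnp d s x \<ge> 0" "mixp d s x - sgnp d s x \<ge> 0" for x
    using abs_sgnp_le[of d s x] by auto
  show "prob_space (mu d s)"
  proof
    show "emeasure (mu d s) (space (mu d s)) = 1"
      unfolding mu_def mixture_density_eq using ip iq nn
      by (simp add: emeasure_density nn_integral_eq_integral)
  qed
  show "prob_space (nu d s)"
  proof
    show "emeasure (nu d s) (space (nu d s)) = 1"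
      unfolding nu_def mixture_density_eq using ip iq nn
      by (simp add: emeasure_density nn_integral_eq_integral)
  qed
qed

text \<open>In the difference the \<open>mixp\<close> parts cancel and the \<open>sgnp\<close> parts
  add up. Integrability against \<open>mixp\<close> covers the other three integrals by
  domination.\<close>

lemma integral_mu_minus_nu:
  assumes [measurable]: "f \<in> borel_measurable (leb d)" and int: "integrable (leb d) (\<lambda>x. f x * mixp d s x)"
  shows "integrable (mu d s) f" "integrable (nu d s) f"
    "integrable (leb d) (\<lambda>x. f x * sgnp d s x)"
    "integral\<^sup>L (mu d s) f - integral\<^sup>L (nu d s) f = 2 * (\<integral>x. f x * sgnp d s x \<partial>leb d)"
proof -
  have nn: "mixp d s x + sgnp d s x \<ge> 0" "mixp d s x - sgnp d s x \<ge> 0" for x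
    using abs_sgnp_le[of d s x] by auto
  show iq: "integrable (leb d) (\<lambda>x. f x * sgnp d s x)"
  proof (rule Bochner_Integration.integrable_bound[OF int])
    show "AE x in leb d. norm (f x * sgnp d s x) \<le> norm (f x * mixp d s x)"
      using abs_sgnp_le[of d s] by (auto simp: abs_mult intro!: AE_I2 mult_left_mono intro: order_trans[OF _ abs_ge_self])
  qed measurable
  have i1: "integrable (leb d) (\<lambda>x. (mixp d s x + sgnp d s x) * f x)"
    using Bochner_Integration.integrable_add[OF int iq] by (simp add: algebra_simps)
  have i2: "integrable (leb d) (\<lambda>x. (mixp d s x - sgnp d s x) * f x)"
    using Bochner_Integration.integrable_diff[OF int iq] by (simp add: algebra_simps)
  show "integrable (mu d s) f" "integrable (nu d s) f"
    unfolding mu_def nu_def mixture_density_eq using i1 i2 nn by (auto simp: integrable_density)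
  have "integral\<^sup>L (mu d s) f - integral\<^sup>L (nu d s) f =
     (\<integral>x. (mixp d s x + sgnp d s x) * f x - (mixp d s x - sgnp d s x) * f x \<partial>leb d)"
    unfolding mu_def nu_def mixture_density_eq using i1 i2 nn by (simp add: integral_density)
  also have "\<dots> = (\<integral>x. 2 * (f x * sgnp d s x) \<partial>leb d)"
    by (simp add: algebra_simps)
  finally show "integral\<^sup>L (mu d s) f - integral\<^sup>L (nu d s) f = 2 * (\<integral>x. f x * sgnp d s x \<partial>leb d)"
    by simp
qed

section \<open>Fourier representation\<close>

text \<open>An affine substitution reduces the transform to the characteristic function of the
  standard normal distribution.\<close>

lemma integral_iexp_normal_density:
  assumes s: "s > 0"
  shows "integrable lborel (\<lambda>x. normal_density \<mu> s x *\<^sub>R iexp (\<xi> * x))"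
    and "(\<integral>x. normal_density \<mu> s x *\<^sub>R iexp (\<xi> * x) \<partial>lborel)
      = iexp (\<xi> * \<mu>) * of_real (exp (- (s * \<xi>)\<^sup>2 / 2))"
proof -
  show "integrable lborel (\<lambda>x. normal_density \<mu> s x *\<^sub>R iexp (\<xi> * x))"
    using integrable_normal_density[OF s, of \<mu>]
    by (rule Bochner_Integration.integrable_bound) (auto simp: normal_density_nonneg)
  have "(\<integral>x. normal_density \<mu> s x *\<^sub>R iexp (\<xi> * x) \<partial>lborel)
      = s *\<^sub>R (\<integral>x. normal_density \<mu> s (\<mu> + s * x) *\<^sub>R iexp (\<xi> * (\<mu> + s * x)) \<partial>lborel)"
    using s by (subst lborel_integral_real_affine[where c=s and t=\<mu>]) auto
  also have "\<dots> = (\<integral>x. iexp (\<xi> * \<mu>) * (std_normal_density x *\<^sub>R iexp ((s * \<xi>) * x)) \<partial>lborel)"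
    unfolding integral_scaleR_right[symmetric]
  proof (intro Bochner_Integration.integral_cong refl)
    fix x
    have "s * normal_density \<mu> s (\<mu> + s * x) = std_normal_density x"
      using s by (simp add: normal_density_def real_sqrt_mult power_mult_distrib)
    moreover have "iexp (\<xi> * (\<mu> + s * x)) = iexp (\<xi> * \<mu>) * iexp ((s * \<xi>) * x)"
      by (simp add: exp_add[symmetric] algebra_simps)
    ultimately show "s *\<^sub>R normal_density \<mu> s (\<mu> + s * x) *\<^sub>R iexp (\<xi> * (\<mu> + s * x))
        = iexp (\<xi> * \<mu>) * (std_normal_density x *\<^sub>R iexp ((s * \<xi>) * x))"
      by (simp only: scaleR_scaleR mult_scaleR_right)
  qed
  also have "\<dots> = iexp (\<xi> * \<mu>) * char std_normal_distribution (s * \<xi>)"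
    unfolding char_def
    by (subst integral_mult_right_zero, subst integral_density) (auto simp: normal_density_nonneg)
  also have "\<dots> = iexp (\<xi> * \<mu>) * of_real (exp (- (s * \<xi>)\<^sup>2 / 2))"
    by (simp add: char_std_normal_distribution)
  finally show "(\<integral>x. normal_density \<mu> s x *\<^sub>R iexp (\<xi> * x) \<partial>lborel)
      = iexp (\<xi> * \<mu>) * of_real (exp (- (s * \<xi>)\<^sup>2 / 2))" .
qed

text \<open>The four shifted Gaussians have the same transform up to phases, and the signed phases
  combine to \<open>4 * \<i> * cos (\<xi> / 2) * sin \<xi>\<close>. With
  \<open>\<xi> = 2 * x\<close> the trigonometric factor is the function whose supremum is
  \<open>kappa\<close>.\<close>

lemma sgnd_fourier:
  assumes s: "s > 0"
  shows "integrable lborel (\<lambda>x. sgnd s x *\<^sub>R iexp (\<xi> * x))"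
    and "cmod (\<integral>x. sgnd s x *\<^sub>R iexp (\<xi> * x) \<partial>lborel)
      = exp (- (s * \<xi>)\<^sup>2 / 2) * \<bar>cos (\<xi> / 2) * sin \<xi>\<bar>"
proof -
  note i = integral_iexp_normal_density[OF s]
  have eq: "sgnd s x *\<^sub>R iexp (\<xi> * x) = (1/4) *\<^sub>R (normal_density (1/2) s x *\<^sub>R iexp (\<xi> * x)
      + normal_density (3/2) s x *\<^sub>R iexp (\<xi> * x) - normal_density (-1/2) s x *\<^sub>R iexp (\<xi> * x)
      - normal_density (-3/2) s x *\<^sub>R iexp (\<xi> * x))" for x
    unfolding sgnd_eq scaleR_conv_of_real by (simp add: field_simps)
  have h: "has_bochner_integral lborel (\<lambda>x. normal_density \<mu> s x *\<^sub>R iexp (\<xi> * x))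
      (iexp (\<xi> * \<mu>) * of_real (exp (- (s * \<xi>)\<^sup>2 / 2)))" for \<mu>
    using i by (simp only: has_bochner_integral_iff)
  have hb: "has_bochner_integral lborel (\<lambda>x. sgnd s x *\<^sub>R iexp (\<xi> * x))
      ((1/4) *\<^sub>R ((iexp (\<xi> * (1/2)) + iexp (\<xi> * (3/2)) - iexp (\<xi> * (-1/2)) - iexp (\<xi> * (-3/2)))
          * of_real (exp (- (s * \<xi>)\<^sup>2 / 2))))"
    unfolding eq distrib_right left_diff_distrib
    by (intro has_bochner_integral_scaleR_right has_bochner_integral_diff has_bochner_integral_add h)
  then show "integrable lborel (\<lambda>x. sgnd s x *\<^sub>R iexp (\<xi> * x))"
    by (rule integrable.intros)
  have sc: "sin (\<xi> / 2) + sin (\<xi> * 3 / 2) = 2 * (sin \<xi> * cos (\<xi> / 2))"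
    using sin_times_cos[of \<xi> "\<xi>/2"] by (simp add: field_simps)
  have "(\<integral>x. sgnd s x *\<^sub>R iexp (\<xi> * x) \<partial>lborel)
      = (1/4) *\<^sub>R ((iexp (\<xi> * (1/2)) + iexp (\<xi> * (3/2)) - iexp (\<xi> * (-1/2)) - iexp (\<xi> * (-3/2)))
          * of_real (exp (- (s * \<xi>)\<^sup>2 / 2)))"
    using hb by (rule has_bochner_integral_integral_eq)
  also have "iexp (\<xi> * (1/2)) + iexp (\<xi> * (3/2)) - iexp (\<xi> * (-1/2)) - iexp (\<xi> * (-3/2))
      = \<i> * of_real (2 * (sin (\<xi> / 2) + sin (\<xi> * 3 / 2)))"
    unfolding cis_conv_exp[symmetric] by (simp add: complex_eq_iff)
  also have "\<dots> = \<i> * of_real (4 * (cos (\<xi> / 2) * sin \<xi>))"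
    unfolding sc by (simp add: mult.commute)
  finally show "cmod (\<integral>x. sgnd s x *\<^sub>R iexp (\<xi> * x) \<partial>lborel)
      = exp (- (s * \<xi>)\<^sup>2 / 2) * \<bar>cos (\<xi> / 2) * sin \<xi>\<bar>"
    by (simp add: norm_mult abs_mult)
qed

text \<open>The cosine is the real part of an exponential, which splits over the coordinates. The
  shift \<open>b\<close> contributes only a phase, so the bound is uniform in
  \<open>b\<close>.\<close>

lemma cos_sgnp_integral_le:
  assumes s: "s > 0"
  shows "\<bar>\<integral>x. cos (t * (dot d \<theta> x - b)) * sgnp d s x \<partial>leb d\<bar>
    \<le> (\<Prod>i=1..d. exp (- (s * (t * \<theta> i))\<^sup>2 / 2) * \<bar>cos (t * \<theta> i / 2) * sin (t * \<theta> i)\<bar>)"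
proof -
  let ?f = "\<lambda>i y. sgnd s y *\<^sub>R iexp ((t * \<theta> i) * y)"
  have int: "integrable (leb d) (\<lambda>x. \<Prod>i=1..d. ?f i (x i))"
    by (intro leb_integrable_prod sgnd_fourier s)
  have eq: "iexp (- (t * b)) * (\<Prod>i=1..d. ?f i (x i)) = sgnp d s x *\<^sub>R iexp (t * (dot d \<theta> x - b))" for x
  proof -
    have "(\<Prod>i=1..d. ?f i (x i)) = of_real (sgnp d s x) * iexp (t * dot d \<theta> x)"
      unfolding sgnp_def scaleR_conv_of_real prod.distrib dot_def of_real_prod
      by (simp add: exp_sum[symmetric] sum_distrib_left mult.assoc)
    moreover have "iexp (t * (dot d \<theta> x - b)) = iexp (- (t * b)) * iexp (t * dot d \<theta> x)"
      by (simp add: exp_add[symmetric] algebra_simps)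
    ultimately show ?thesis by (simp add: scaleR_conv_of_real)
  qed
  have "(\<integral>x. cos (t * (dot d \<theta> x - b)) * sgnp d s x \<partial>leb d)
      = (\<integral>x. Re (iexp (- (t * b)) * (\<Prod>i=1..d. ?f i (x i))) \<partial>leb d)"
    unfolding eq by (simp add: cis_conv_exp[symmetric] mult.commute del: of_real_mult of_real_diff)
  also have "\<dots> = Re (\<integral>x. iexp (- (t * b)) * (\<Prod>i=1..d. ?f i (x i)) \<partial>leb d)"
    by (rule integral_Re) (intro integrable_mult_right int)
  also have "\<dots> = Re (iexp (- (t * b)) * (\<Prod>i=1..d. \<integral>y. ?f i y \<partial>lborel))"
    by (simp only: integral_mult_right_zero leb_integral_prod[OF sgnd_fourier(1)[OF s]])
  also have "\<bar>\<dots>\<bar> \<le> cmod (\<Prod>i=1..d. \<integral>y. ?f i y \<partial>lborel)"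
    by (rule order_trans[OF abs_Re_le_cmod]) (simp add: norm_mult)
  finally show ?thesis
    unfolding prod_norm[symmetric] sgnd_fourier(2)[OF s] by simp
qed

section \<open>The absolute value as an integral of cosines\<close>

lemma one_minus_cos_le: "1 - cos t \<le> 4 * t\<^sup>2 / (1 + t\<^sup>2)" for t :: real
proof (cases "\<bar>t\<bar> \<le> 1")
  case True
  then have "t\<^sup>2 \<le> 1" by (simp add: abs_square_le_1)
  have "1 - cos t = 2 * (sin (t/2))\<^sup>2" using cos_double_sin[of "t/2"] by simp
  also have "\<dots> \<le> 2 * \<bar>t/2\<bar>\<^sup>2"
    using abs_sin_x_le_abs_x[of "t/2"] by (simp add: power2_le_iff_abs_le)
  also have "\<dots> = t\<^sup>2 / 2" by (simp add: power2_eq_square)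
  also have "\<dots> \<le> 4 * t\<^sup>2 / (1 + t\<^sup>2)"
  proof -
    have "t\<^sup>2 * t\<^sup>2 \<le> t\<^sup>2" "0 \<le> t\<^sup>2"
      using mult_left_mono[OF \<open>t\<^sup>2 \<le> 1\<close>, of "t\<^sup>2"] by auto
    moreover have "t\<^sup>2 / 2 * (1 + t\<^sup>2) = t\<^sup>2 / 2 + (t\<^sup>2 * t\<^sup>2) / 2"
      by (simp add: algebra_simps)
    ultimately have "t\<^sup>2 / 2 * (1 + t\<^sup>2) \<le> 4 * t\<^sup>2" by linarith
    then show ?thesis by (simp only: pos_le_divide_eq add_pos_nonneg zero_less_one zero_le_power2)
  qed
  finally show ?thesis .
next
  case False
  then have "t\<^sup>2 > 1" by (simp add: abs_square_le_1[symmetric] not_le[symmetric])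
  then have "2 \<le> 4 * t\<^sup>2 / (1 + t\<^sup>2)" by (simp add: field_simps)
  moreover have "1 - cos t \<le> 2" using cos_ge_minus_one[of t] by simp
  ultimately show ?thesis by linarith
qed

text \<open>Only \<open>0 < absc < \<infinity>\<close> matters, so its value \<open>\<pi>\<close> is never computed.\<close>

definition absc :: real where
  "absc = (\<integral>t. (1 - cos t) / t\<^sup>2 \<partial>lborel)"

text \<open>The bound on \<open>1 - cos t\<close> is quadratic at 0 and bounded at infinity, so
  dividing it by the square of \<open>t\<close> leaves a multiple of the Cauchy kernel. At
  \<open>t = 0\<close> the integrand is 0, by the value of division by zero.\<close>

lemma integrable_absc: "integrable lborel (\<lambda>t::real. (1 - cos t) / t\<^sup>2)"
proof (rule Bochner_Integration.integrable_bound)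
  have "set_integrable lborel (einterval (-\<infinity>) \<infinity>) (\<lambda>x. inverse (1 + x\<^sup>2))"
    by (rule integrable_inverse_1_plus_square)
  then show "integrable lborel (\<lambda>t::real. 4 * inverse (1 + t\<^sup>2))"
    by (simp add: set_integrable_def)
  have "(1 - cos t) / t\<^sup>2 \<le> 4 * inverse (1 + t\<^sup>2)" for t :: real
  proof (cases "t = 0")
    case False
    have "(1 - cos t) / t\<^sup>2 \<le> (4 * t\<^sup>2 / (1 + t\<^sup>2)) / t\<^sup>2"
      by (intro divide_right_mono one_minus_cos_le) auto
    also have "\<dots> = 4 * inverse (1 + t\<^sup>2)"
      using False by (simp add: divide_inverse)
    finally show ?thesis .
  qed simp
  then show "AE t::real in lborel. norm ((1 - cos t) / t\<^sup>2) \<le> norm (4 * inverse (1 + t\<^sup>2) :: real)"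
    by (simp add: abs_of_nonneg)
qed measurable

text \<open>The integrand is nonnegative, and on \<open>{1..2}\<close> it is bounded below by a
  positive constant because \<open>cos t \<le> cos 1 < 1\<close> there.\<close>

lemma absc_pos: "absc > 0"
proof -
  have le: "(1 - cos 1) / 4 * indicator {1..2} t \<le> (1 - cos t) / t\<^sup>2" for t :: real
  proof (cases "t \<in> {1..2}")
    case True
    then have "cos t \<le> cos 1" using pi_gt3 by (intro cos_monotone_0_pi_le) auto
    moreover have "t\<^sup>2 \<le> 4" using True power_mono[of t 2 2] by simp
    ultimately have "(1 - cos 1) / 4 \<le> (1 - cos t) / t\<^sup>2"
      using True by (intro frac_le) auto
    then show ?thesis using True by simp
  next
    case False
    then show ?thesis by simp
  qed
  have "cos (1::real) < 1"
    using cos_monotone_0_pi[of 0 1] pi_gt3 by simp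
  then have "0 < (1 - cos 1) / (4::real)" by simp
  also have "\<dots> = (\<integral>t. (1 - cos 1) / 4 * indicator {1..2::real} t \<partial>lborel)"
    by simp
  also have "\<dots> \<le> absc"
    unfolding absc_def by (intro integral_mono integrable_absc le) auto
  finally show ?thesis .
qed

text \<open>Substituting \<open>u * t\<close> scales the weight by the square of \<open>u\<close>
  and the measure by \<open>1 / \<bar>u\<bar>\<close>, which leaves
  \<open>\<bar>u\<bar>\<close>.\<close>

lemma abs_fourier:
  shows "integrable lborel (\<lambda>t. (1 - cos (t * u)) / t\<^sup>2)"
    and "(\<integral>t. (1 - cos (t * u)) / t\<^sup>2 \<partial>lborel) = absc * \<bar>u\<bar>"
proof -
  have "integrable lborel (\<lambda>t. (1 - cos (t * u)) / t\<^sup>2) \<and>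
    (\<integral>t. (1 - cos (t * u)) / t\<^sup>2 \<partial>lborel) = absc * \<bar>u\<bar>"
  proof (cases "u = 0")
    case False
    have eq: "(1 - cos (t * u)) / t\<^sup>2 = u\<^sup>2 * ((1 - cos (0 + u * t)) / (0 + u * t)\<^sup>2)" for t
      using False by (simp add: power_mult_distrib mult.commute)
    have "(\<integral>t. (1 - cos (0 + u * t)) / (0 + u * t)\<^sup>2 \<partial>lborel) = absc / \<bar>u\<bar>"
      unfolding absc_def using False by (subst lborel_integral_real_affine[where c=u and t=0]) auto
    moreover have "u\<^sup>2 * (absc / \<bar>u\<bar>) = absc * \<bar>u\<bar>"
      using False by (simp add: power2_eq_square abs_if)
    moreover note lborel_integrable_real_affine[OF integrable_absc False, of 0]
    ultimately show ?thesis
      unfolding eq by (simp only: integral_mult_right_zero integrable_mult_right simp_thms)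
  qed simp
  then show "integrable lborel (\<lambda>t. (1 - cos (t * u)) / t\<^sup>2)"
    and "(\<integral>t. (1 - cos (t * u)) / t\<^sup>2 \<partial>lborel) = absc * \<bar>u\<bar>" by auto
qed

section \<open>Numerical bounds for \<open>kappa\<close>\<close>

lemma cubic_le: "2 * t * (1 - t\<^sup>2) \<le> 4 * a ^ 3" if "t \<ge> 0" "a \<ge> 0" "3 * a\<^sup>2 \<ge> 1" for a t :: real
proof -
  \<comment> \<open>This cubic has a double root at \<open>a\<close>. For
    \<open>a = 1 / sqrt 3\<close> it expresses the tangency at the maximum of
    \<open>2 * t * (1 - t\<^sup>2)\<close>; a slightly larger rational \<open>a\<close> still gives
    an upper bound.\<close>
  have "0 \<le> (t - a)\<^sup>2 * (t + 2 * a)" using that by simp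
  also have "\<dots> = t ^ 3 - 3 * a\<^sup>2 * t + 2 * a ^ 3"
    by (simp add: power2_eq_square power3_eq_cube algebra_simps)
  finally have "2 * (t - t ^ 3) \<le> 2 * ((1 - 3 * a\<^sup>2) * t) + 4 * a ^ 3"
    by (simp add: algebra_simps)
  also have "(1 - 3 * a\<^sup>2) * t \<le> 0" using that by (intro mult_nonpos_nonneg) auto
  finally show ?thesis by (simp add: algebra_simps power2_eq_square power3_eq_cube)
qed

text \<open>In terms of \<open>\<bar>sin x\<bar>\<close> the maximisation concerns the cubic of
  \<open>cubic_le\<close>, with maximiser \<open>1 / sqrt 3\<close>.\<close>

lemma abs_cos_sin_double: "\<bar>cos x * sin (2 * x)\<bar> = 2 * \<bar>sin x\<bar> * (1 - \<bar>sin x\<bar>\<^sup>2)" for x :: real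
proof -
  have "cos x * sin (2 * x) = 2 * sin x * (cos x)\<^sup>2"
    by (simp add: sin_double power2_eq_square)
  then have "\<bar>cos x * sin (2 * x)\<bar> = \<bar>2 * sin x * (cos x)\<^sup>2\<bar>"
    by simp
  also have "\<dots> = 2 * \<bar>sin x\<bar> * (cos x)\<^sup>2" by (simp add: abs_mult)
  finally show ?thesis by (simp add: cos_squared_eq)
qed

text \<open>\<open>0.57736\<close> is \<open>1 / sqrt 3\<close> rounded up, so that
  \<open>3 * a\<^sup>2 \<ge> 1\<close> holds.\<close>

lemma abs_cos_sin_double_le: "\<bar>cos x * sin (2 * x)\<bar> \<le> 4 * 0.57736 ^ 3" for x :: real
  unfolding abs_cos_sin_double by (rule cubic_le) (auto simp: power2_eq_square)

lemma abs_cos_sin_le_kappa: "\<bar>cos (\<xi> / 2) * sin \<xi>\<bar> \<le> kappa"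
proof -
  have "bdd_above (range (\<lambda>x::real. \<bar>cos x * sin (2 * x)\<bar>))"
    by (rule bdd_aboveI2) (rule abs_cos_sin_double_le)
  from cSUP_upper[OF _ this, of "\<xi> / 2"] show ?thesis by (simp add: kappa_def)
qed

lemma kappa_less: "kappa < 0.7699"
proof -
  have "kappa \<le> 4 * 0.57736 ^ 3"
    unfolding kappa_def by (intro cSUP_least abs_cos_sin_double_le) auto
  then show ?thesis by (simp add: power3_eq_cube)
qed

text \<open>The function is evaluated where the sine is \<open>0.57735\<close>, just below the
  maximiser \<open>1 / sqrt 3\<close>.\<close>

lemma kappa_ge: "0.7698 \<le> kappa"
proof -
  have "0.7698 \<le> \<bar>cos (arcsin 0.57735) * sin (2 * arcsin 0.57735)\<bar>"
    unfolding abs_cos_sin_double by (simp add: power2_eq_square)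
  also have "\<dots> \<le> kappa"
    using abs_cos_sin_le_kappa[of "2 * arcsin 0.57735"] by simp
  finally show ?thesis .
qed

lemma kappa_pos: "kappa > 0"
  using kappa_ge by simp

section \<open>Two-layer networks\<close>

lemma sd_ex1:
  assumes "d \<ge> 1"
  shows "\<exists>!s. s > 0 \<and> sd_eq (1/8) (1/8) d s"
proof -
  define c where "c = real d / (sqrt (2 * pi) * (1/8) * (1/8))"
  have c: "c > 0" unfolding c_def using assms by simp
  \<comment> \<open>The equation becomes \<open>h s = 0\<close>. Both terms of \<open>h\<close>
    increase with \<open>s\<close>, which gives uniqueness; existence follows from a sign
    change.\<close>
  define h where "h s = ln (c * s) - (1/8)\<^sup>2 / (2 * s\<^sup>2)" for s :: real
  have iff: "sd_eq (1/8) (1/8) d s \<longleftrightarrow> h s = 0" for s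
  proof -
    have "real d * s / (sqrt (2 * pi) * (1/8) * (1/8)) = c * s" unfolding c_def by simp
    then show ?thesis unfolding sd_eq_def h_def by auto
  qed
  have mono: "h s < h t" if "0 < s" "s < t" for s t
  proof -
    have "ln (c * s) < ln (c * t)" using that c by simp
    moreover have "(1/8)\<^sup>2 / (2 * t\<^sup>2) \<le> (1/8)\<^sup>2 / (2 * s\<^sup>2)"
      using that by (intro divide_left_mono mult_left_mono power_mono) auto
    ultimately show ?thesis unfolding h_def by linarith
  qed
  \<comment> \<open>At \<open>u\<close> the logarithm is at least 1 and the subtracted quotient at
    most 1. The left end \<open>1 / c\<close> used below makes the logarithm vanish.\<close>
  define u where "u = max 1 (exp 1 / c)"
  have u: "1 \<le> u" "exp 1 / c \<le> u" unfolding u_def by auto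
  have "exp 1 \<le> c * u" using u(2) c by (simp add: field_simps)
  then have "1 \<le> ln (c * u)" using c u by (subst ln_ge_iff) auto
  moreover have "(1/8)\<^sup>2 / (2 * u\<^sup>2) \<le> 1"
  proof -
    have "1 \<le> u\<^sup>2" using u(1) by simp
    then show ?thesis by (simp add: field_simps power2_eq_square)
  qed
  ultimately have hu: "0 \<le> h u" unfolding h_def by linarith
  have hl: "h (1 / c) \<le> 0" unfolding h_def using c by simp
  have lu: "1 / c \<le> u"
    using u(2) c by (intro order_trans[OF _ u(2)] divide_right_mono) auto
  have "continuous_on {1/c..u} h"
    unfolding h_def using c
    by (auto intro!: continuous_intros simp: divide_le_eq mult_eq_0_iff dest: order_trans)
  from IVT'[OF hl hu lu this] obtain s where s: "1 / c \<le> s" "h s = 0" by auto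
  have "s > 0" using s(1) c by (meson divide_pos_pos less_le_trans zero_less_one)
  with s(2) show ?thesis
    unfolding iff using mono by (intro ex1I[of _ s]) (auto, metis less_irrefl linorder_neqE_linordered_idom)
qed

lemma sd_pos: "sd d > 0" and sd_eq_sd: "sd_eq (1/8) (1/8) d (sd d)" if "d \<ge> 1"
  using theI'[OF sd_ex1[OF that]] unfolding sd_def by auto

text \<open>The left side of the defining equation is positive, so the argument of the logarithm
  exceeds 1; this is a lower bound for \<open>sd d\<close>.\<close>

lemma inverse_sd_le:
  assumes "d \<ge> 1"
  shows "1 / sd d \<le> 64 * real d / sqrt (2 * pi)"
proof -
  note s = sd_pos[OF assms]
  define y where "y = real d * sd d / (sqrt (2 * pi) * (1/8) * (1/8))"
  have y: "y > 0" unfolding y_def using s assms by simp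
  have "0 < (1/8)\<^sup>2 / (2 * (sd d)\<^sup>2)" using s by simp
  also have "\<dots> = ln y" using sd_eq_sd[OF assms] unfolding sd_eq_def y_def by simp
  finally have "1 < y" using y by simp
  then show ?thesis using s unfolding y_def by (simp add: field_simps)
qed

lemma enorm_nonneg [simp]: "enorm d x \<ge> 0"
  by (simp add: enorm_def L2_set_nonneg)

lemma abs_le_enorm: "i \<in> {1..d} \<Longrightarrow> \<bar>\<theta> i\<bar> \<le> enorm d \<theta>"
proof -
  assume "i \<in> {1..d}"
  then have "(\<theta> i)\<^sup>2 \<le> (\<Sum>i=1..d. (\<theta> i)\<^sup>2)" by (intro member_le_sum) auto
  then show ?thesis
    unfolding enorm_def L2_set_def using real_sqrt_le_mono by fastforce
qed

lemma relu_eq: "relu u = (u + \<bar>u\<bar>) / 2"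
  by (simp add: relu_def max_def)

lemma abs_relu_le: "\<bar>relu u\<bar> \<le> \<bar>u\<bar>"
  by (simp add: relu_def)

lemma relu_measurable [measurable]: "relu \<in> borel_measurable borel"
  unfolding relu_def by measurable

lemma abs_dot_le: "\<bar>dot d \<theta> x\<bar> \<le> (\<Sum>i=1..d. \<bar>\<theta> i\<bar> * \<bar>x i\<bar>)"
  unfolding dot_def by (rule order_trans[OF sum_abs]) (simp add: abs_mult)

text \<open>Two of the sine factors are traded for \<open>t\<^sup>2\<close>, to cancel the singular weight \<open>1 / t\<^sup>2\<close>.\<close>

lemma fourier_product_le:
  assumes "d \<ge> 2"
  shows "(\<Prod>i=1..d. exp (- (s * (t * \<theta> i))\<^sup>2 / 2) * \<bar>cos (t * \<theta> i / 2) * sin (t * \<theta> i)\<bar>)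
    \<le> kappa ^ (d - 2) * (enorm d \<theta>)\<^sup>2 * t\<^sup>2 * exp (- (s * enorm d \<theta> * t)\<^sup>2 / 2)"
proof -
  let ?c = "\<lambda>i. \<bar>cos (t * \<theta> i / 2) * sin (t * \<theta> i)\<bar>"
  have e: "(\<Prod>i=1..d. exp (- (s * (t * \<theta> i))\<^sup>2 / 2)) = exp (- (s * enorm d \<theta> * t)\<^sup>2 / 2)"
  proof -
    have "(enorm d \<theta>)\<^sup>2 = (\<Sum>i=1..d. (\<theta> i)\<^sup>2)"
      by (simp add: enorm_def L2_set_def sum_nonneg)
    then have "(\<Sum>i=1..d. - (s * (t * \<theta> i))\<^sup>2 / 2) = - (s * enorm d \<theta> * t)\<^sup>2 / 2"
      by (simp add: power_mult_distrib sum_negf sum_divide_distrib[symmetric] sum_distrib_left[symmetric])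
    then show ?thesis by (simp add: exp_sum[symmetric])
  qed
  have c: "?c i \<le> \<bar>t\<bar> * enorm d \<theta>" if "i \<in> {1..d}" for i
  proof -
    have "?c i \<le> 1 * \<bar>t * \<theta> i\<bar>"
      unfolding abs_mult[of "cos _"] by (intro mult_mono abs_sin_x_le_abs_x) auto
    also have "\<dots> \<le> \<bar>t\<bar> * enorm d \<theta>"
      using abs_le_enorm[OF that, of \<theta>] by (simp add: abs_mult mult_left_mono)
    finally show ?thesis .
  qed
  \<comment> \<open>The first two coordinates supply the two factors to be traded; this is where
    \<open>d \<ge> 2\<close> enters.\<close>
  have "{1..d} = insert 1 (insert 2 {3..d})" using assms by auto
  then have "(\<Prod>i=1..d. ?c i) = ?c 1 * (?c 2 * (\<Prod>i=3..d. ?c i))"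
    by simp
  also have "\<dots> \<le> (\<bar>t\<bar> * enorm d \<theta>) * ((\<bar>t\<bar> * enorm d \<theta>) * (\<Prod>i=3..d. kappa))"
    using assms kappa_pos
    by (intro mult_mono c prod_mono conjI abs_cos_sin_le_kappa mult_nonneg_nonneg prod_nonneg) auto
  also have "\<dots> = kappa ^ (d - 2) * (enorm d \<theta>)\<^sup>2 * t\<^sup>2"
    by (simp add: power2_eq_square abs_mult[symmetric] mult_ac)
  finally have "(\<Prod>i=1..d. ?c i) \<le> kappa ^ (d - 2) * (enorm d \<theta>)\<^sup>2 * t\<^sup>2" .
  then show ?thesis
    unfolding prod.distrib e by (subst mult.commute) (intro mult_right_mono, auto)
qed

lemma integral_exp_square:
  assumes "a > 0"
  shows "integrable lborel (\<lambda>t. exp (- (a * t)\<^sup>2 / 2))"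
    and "(\<integral>t. exp (- (a * t)\<^sup>2 / 2) \<partial>lborel) = sqrt (2 * pi) / a"
proof -
  have eq: "exp (- (a * t)\<^sup>2 / 2) = sqrt (2 * pi) / a * normal_density 0 (1 / a) t" for t
    using assms by (simp add: normal_density_def real_sqrt_divide power_mult_distrib power_divide mult.commute)
  show "integrable lborel (\<lambda>t. exp (- (a * t)\<^sup>2 / 2))"
    and "(\<integral>t. exp (- (a * t)\<^sup>2 / 2) \<partial>lborel) = sqrt (2 * pi) / a"
    unfolding eq using assms by auto
qed

context
  fixes s :: real and d :: nat
  assumes s: "s > 0" and d: "d \<ge> 1"
begin

lemma integrable_mixp: "integrable (leb d) (mixp d s)"
  unfolding mixp_def using s by (intro leb_integrable_prod) auto

lemma integral_sgnp: "integrable (leb d) (sgnp d s)" "integral\<^sup>L (leb d) (sgnp d s) = 0"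
  unfolding sgnp_def using s d leb_integrable_prod[of d "\<lambda>_. sgnd s"] leb_integral_prod[of d "\<lambda>_. sgnd s"]
  by (simp_all add: power_0_left)

text \<open>Putting \<open>\<bar>y\<bar>\<close> into the \<open>i\<close>-th factor keeps the
  integrand a product function, and each factor is integrable.\<close>

lemma integrable_component_mixp:
  assumes i: "i \<in> {1..d}"
  shows "integrable (leb d) (\<lambda>x. \<bar>x i\<bar> * mixp d s x)"
proof -
  have "integrable lborel (\<lambda>y. (if j = i then \<bar>y\<bar> else 1) * mixd s y)" for j
    using integrable_mixd_times_abs[OF s] s by (cases "j = i") simp_all
  then have "integrable (leb d) (\<lambda>x. \<Prod>j=1..d. (if j = i then \<bar>x j\<bar> else 1) * mixd s (x j))"
    by (rule leb_integrable_prod)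
  then show ?thesis
    unfolding prod.distrib mixp_def using i by (simp add: prod.delta)
qed

lemma integrable_linear_growth:
  assumes [measurable]: "f \<in> borel_measurable (leb d)"
    and le: "\<And>x. \<bar>f x\<bar> \<le> (\<Sum>i=1..d. \<bar>\<theta> i\<bar> * \<bar>x i\<bar>) + \<bar>c\<bar>"
  shows "integrable (leb d) (\<lambda>x. f x * mixp d s x)"
proof (rule Bochner_Integration.integrable_bound)
  show "integrable (leb d) (\<lambda>x. (\<Sum>i=1..d. \<bar>\<theta> i\<bar> * (\<bar>x i\<bar> * mixp d s x)) + \<bar>c\<bar> * mixp d s x)"
    by (intro Bochner_Integration.integrable_add Bochner_Integration.integrable_sum
        integrable_mult_right integrable_component_mixp integrable_mixp)
  have nn: "mixp d s x \<ge> 0" for x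
    unfolding mixp_def by (intro prod_nonneg) (auto intro: mixd_nonneg)
  have "\<bar>f x\<bar> * mixp d s x \<le> (\<Sum>i=1..d. \<bar>\<theta> i\<bar> * (\<bar>x i\<bar> * mixp d s x)) + \<bar>c\<bar> * mixp d s x" for x
    using mult_right_mono[OF le[of x] nn[of x]] by (simp add: distrib_right sum_distrib_right mult.assoc)
  then show "AE x in leb d. norm (f x * mixp d s x)
      \<le> norm ((\<Sum>i=1..d. \<bar>\<theta> i\<bar> * (\<bar>x i\<bar> * mixp d s x)) + \<bar>c\<bar> * mixp d s x)"
    by (auto simp: abs_mult nn intro!: AE_I2 order_trans[OF _ abs_ge_self])
qed measurable

lemma integrable_neuron: "integrable (leb d) (\<lambda>x. relu (dot d \<theta> x - b) * mixp d s x)"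
proof (rule integrable_linear_growth[where \<theta>=\<theta> and c=b])
  show "\<bar>relu (dot d \<theta> x - b)\<bar> \<le> (\<Sum>i=1..d. \<bar>\<theta> i\<bar> * \<bar>x i\<bar>) + \<bar>b\<bar>" for x
    using abs_dot_le[of d \<theta> x] abs_relu_le[of "dot d \<theta> x - b"] by linarith
qed measurable

text \<open>A coordinate function alters only one factor of \<open>sgnp\<close>. For
  \<open>d \<ge> 2\<close> some other factor is left untouched, and it integrates to 0.\<close>

lemma integral_component_sgnp:
  assumes i: "i \<in> {1..d}" and "d \<ge> 2"
  shows "(\<integral>x. x i * sgnp d s x \<partial>leb d) = 0"
proof -
  let ?f = "\<lambda>j y. (if j = i then y else 1) * sgnd s y"
  have 1: "integrable lborel (\<lambda>x. x * sgnd s x)"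
  proof (rule Bochner_Integration.integrable_bound[OF integrable_mixd_times_abs[OF s]])
    show "AE x in lborel. norm (x * sgnd s x) \<le> norm (\<bar>x\<bar> * mixd s x)"
      using abs_sgnd_le[of s] mixd_nonneg[of s] by (auto simp: abs_mult intro!: mult_left_mono)
  qed measurable
  have "(\<integral>x. (\<Prod>j=1..d. ?f j (x j)) \<partial>leb d) = (\<Prod>j=1..d. integral\<^sup>L lborel (?f j))"
  proof (rule leb_integral_prod)
    show "integrable lborel (?f j)" for j
      using 1 s by (cases "j = i") simp_all
  qed
  also have "\<dots> = 0"
  proof (rule prod_zero)
    \<comment> \<open>The witness is an untouched coordinate, chosen among the first two.\<close>
    have "(if i = 1 then 2 else 1) \<in> {1..d}" "(if i = 1 then 2 else 1) \<noteq> i" using assms by auto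
    then show "\<exists>j\<in>{1..d}. integral\<^sup>L lborel (?f j) = 0"
      using integral_sgnd[OF s] by (intro bexI[of _ "if i = 1 then 2 else 1"]) auto
  qed simp
  also have "(\<lambda>x. \<Prod>j=1..d. ?f j (x j)) = (\<lambda>x. x i * sgnp d s x)"
    unfolding prod.distrib sgnp_def using i by (simp add: prod.delta)
  finally show ?thesis .
qed

lemma integral_affine_sgnp:
  assumes "d \<ge> 2"
  shows "(\<integral>x. (dot d \<theta> x - b) * sgnp d s x \<partial>leb d) = 0"
proof -
  have int: "integrable (leb d) (\<lambda>x. x i * sgnp d s x)" if "i \<in> {1..d}" for i
  proof -
    have m: "(\<lambda>x. x i) \<in> borel_measurable (leb d)" using that unfolding leb_def by measurable
    have "integrable (leb d) (\<lambda>x. x i * mixp d s x)"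
    proof (rule Bochner_Integration.integrable_bound[OF integrable_component_mixp[OF that]])
    qed (use m in \<open>auto simp: abs_mult\<close>)
    from integral_mu_minus_nu(3)[OF m this] show ?thesis .
  qed
  have "(\<lambda>x. (dot d \<theta> x - b) * sgnp d s x) = (\<lambda>x. (\<Sum>i=1..d. \<theta> i * (x i * sgnp d s x)) - b * sgnp d s x)"
    by (auto simp: dot_def left_diff_distrib sum_distrib_right mult.assoc)
  moreover have "(\<integral>x. (\<Sum>i=1..d. \<theta> i * (x i * sgnp d s x)) - b * sgnp d s x \<partial>leb d)
     = (\<Sum>i=1..d. \<theta> i * (\<integral>x. x i * sgnp d s x \<partial>leb d)) - b * integral\<^sup>L (leb d) (sgnp d s)"
    by (subst Bochner_Integration.integral_diff)
       (auto intro!: Bochner_Integration.integrable_sum int integral_sgnp simp: Bochner_Integration.integral_sum int)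
  ultimately show ?thesis using integral_component_sgnp[OF _ assms] by (simp add: integral_sgnp)
qed

text \<open>After \<open>\<bar>u\<bar>\<close> is replaced by its cosine integral and the integrals
  are exchanged, the constant term drops out since \<open>sgnp\<close> has integral 0. What remains
  is the transform of \<open>sgnp\<close>, bounded by \<open>fourier_product_le\<close>, and the
  Gaussian integral over \<open>t\<close> produces the factor \<open>1 / s\<close>.\<close>

lemma abs_neuron_sgnp_le:
  assumes d2: "d \<ge> 2"
  shows "absc * \<bar>\<integral>x. \<bar>dot d \<theta> x - b\<bar> * sgnp d s x \<partial>leb d\<bar>
    \<le> kappa ^ (d - 2) * enorm d \<theta> * sqrt (2 * pi) / s"
proof (cases "enorm d \<theta> = 0")
  case True
  then have "dot d \<theta> x = 0" for x
    using abs_le_enorm[of _ d \<theta>] unfolding dot_def by (auto intro!: sum.neutral)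
  then show ?thesis using True integral_sgnp by simp
next
  case False
  define r where "r = enorm d \<theta>"
  have r: "r > 0" using False enorm_nonneg[of d \<theta>] unfolding r_def by linarith
  define u where "u x = dot d \<theta> x - b" for x
  have [measurable]: "u \<in> borel_measurable (leb d)" unfolding u_def by measurable
  define F where "F x t = (1 - cos (t * u x)) / t\<^sup>2 * sgnp d s x" for x t
  interpret sigma_finite_measure "leb d" by (rule sigma_finite_leb)
  interpret pair_sigma_finite "leb d" "lborel :: real measure" ..
  have int_abs: "integrable (leb d) (\<lambda>x. \<bar>u x\<bar> * mixp d s x)"
  proof (rule integrable_linear_growth[where \<theta>=\<theta> and c=b])
    show "\<bar>\<bar>u x\<bar>\<bar> \<le> (\<Sum>i=1..d. \<bar>\<theta> i\<bar> * \<bar>x i\<bar>) + \<bar>b\<bar>" for x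
      using abs_dot_le[of d \<theta> x] unfolding u_def by linarith
  qed measurable
  have int_abs': "integrable (leb d) (\<lambda>x. \<bar>u x\<bar> * sgnp d s x)"
    using integral_mu_minus_nu(3)[OF _ int_abs] by measurable
  have iF: "integrable (leb d \<Otimes>\<^sub>M lborel) (case_prod F)"
  proof (rule Fubini_integrable)
    show "case_prod F \<in> borel_measurable (leb d \<Otimes>\<^sub>M lborel)"
      unfolding F_def by measurable
    \<comment> \<open>The weight is nonnegative, so taking norms affects only \<open>sgnp\<close>,
      and \<open>abs_fourier\<close> evaluates the inner integral exactly.\<close>
    have "(\<integral>t. norm (F x t) \<partial>lborel) = absc * \<bar>\<bar>u x\<bar> * sgnp d s x\<bar>" for x
    proof -
      have "norm (F x t) = (1 - cos (t * u x)) / t\<^sup>2 * \<bar>sgnp d s x\<bar>" for t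
        unfolding F_def by (simp add: abs_mult)
      then show ?thesis
        by (simp only: integral_mult_left_zero abs_fourier abs_mult abs_abs mult.assoc)
    qed
    then show "integrable (leb d) (\<lambda>x. \<integral>t. norm (case (x, t) of (x, t) \<Rightarrow> F x t) \<partial>lborel)"
      using int_abs' by simp
    show "AE x in leb d. integrable lborel (\<lambda>t. case (x, t) of (x, t) \<Rightarrow> F x t)"
      unfolding F_def prod.case by (intro AE_I2 integrable_mult_left abs_fourier)
  qed
  have inner: "(\<integral>x. F x t \<partial>leb d) = - (\<integral>x. cos (t * u x) * sgnp d s x \<partial>leb d) / t\<^sup>2" for t
  proof -
    have ic: "integrable (leb d) (\<lambda>x. cos (t * u x) * sgnp d s x)"
      by (rule Bochner_Integration.integrable_bound[OF integral_sgnp(1)])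
         (auto simp: abs_mult mult_left_le_one_le)
    have "(\<integral>x. F x t \<partial>leb d) = (\<integral>x. (sgnp d s x - cos (t * u x) * sgnp d s x) / t\<^sup>2 \<partial>leb d)"
      unfolding F_def by (simp add: left_diff_distrib diff_divide_distrib)
    also have "\<dots> = (integral\<^sup>L (leb d) (sgnp d s) - (\<integral>x. cos (t * u x) * sgnp d s x \<partial>leb d)) / t\<^sup>2"
      by (subst integral_divide_zero, subst Bochner_Integration.integral_diff) (auto intro: ic integral_sgnp)
    finally show ?thesis by (simp add: integral_sgnp)
  qed
  have inner_le: "\<bar>\<integral>x. F x t \<partial>leb d\<bar> \<le> kappa ^ (d - 2) * r\<^sup>2 * exp (- (s * r * t)\<^sup>2 / 2)" for t
  \<comment> \<open>At \<open>t = 0\<close> division by zero makes the inner integral 0, so the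
    bound holds trivially.\<close>
  proof (cases "t = 0")
    case True
    then show ?thesis unfolding inner using kappa_pos by simp
  next
    case False
    have "\<bar>\<integral>x. F x t \<partial>leb d\<bar> = \<bar>\<integral>x. cos (t * u x) * sgnp d s x \<partial>leb d\<bar> / t\<^sup>2"
      unfolding inner by simp
    also have "\<dots> \<le> (kappa ^ (d - 2) * r\<^sup>2 * t\<^sup>2 * exp (- (s * r * t)\<^sup>2 / 2)) / t\<^sup>2"
      unfolding u_def r_def
      by (intro divide_right_mono order_trans[OF cos_sgnp_integral_le[OF s] fourier_product_le[OF d2]]) auto
    finally show ?thesis using False by simp
  qed
  have "absc * (\<integral>x. \<bar>u x\<bar> * sgnp d s x \<partial>leb d) = (\<integral>x. (\<integral>t. F x t \<partial>lborel) \<partial>leb d)"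
    unfolding F_def by (simp only: integral_mult_left_zero integral_mult_right_zero abs_fourier mult.assoc)
  also have "\<dots> = (\<integral>t. (\<integral>x. F x t \<partial>leb d) \<partial>lborel)"
    using Fubini_integral[OF iF] by simp
  finally have "\<bar>absc * (\<integral>x. \<bar>u x\<bar> * sgnp d s x \<partial>leb d)\<bar>
      = norm (\<integral>t. (\<integral>x. F x t \<partial>leb d) \<partial>lborel)" by simp
  also have "\<dots> \<le> (\<integral>t. kappa ^ (d - 2) * r\<^sup>2 * exp (- (s * r * t)\<^sup>2 / 2) \<partial>lborel)"
    using inner_le r s integrable_snd[OF iF]
    by (intro Bochner_Integration.integral_norm_bound_integral integrable_mult_right integral_exp_square) auto
  also have "\<dots> = kappa ^ (d - 2) * r * sqrt (2 * pi) / s"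
    using r s integral_exp_square(2)[of "s * r"] by (simp add: power2_eq_square)
  finally show ?thesis
    using absc_pos by (simp add: abs_mult u_def r_def)
qed

text \<open>By \<open>relu_eq\<close> a neuron is half the sum of an affine function and its
  absolute value; the affine part integrates to 0 because \<open>d \<ge> 2\<close>.\<close>

lemma neuron_sgnp_le:
  assumes d2: "d \<ge> 2"
  shows "2 * \<bar>\<integral>x. relu (dot d \<theta> x - b) * sgnp d s x \<partial>leb d\<bar>
    \<le> kappa ^ (d - 2) * enorm d \<theta> * sqrt (2 * pi) / s / absc"
proof -
  let ?u = "\<lambda>x. dot d \<theta> x - b"
  have le: "\<bar>?u x\<bar> \<le> (\<Sum>i=1..d. \<bar>\<theta> i\<bar> * \<bar>x i\<bar>) + \<bar>b\<bar>" "\<bar>\<bar>?u x\<bar>\<bar> \<le> (\<Sum>i=1..d. \<bar>\<theta> i\<bar> * \<bar>x i\<bar>) + \<bar>b\<bar>" for x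
    using abs_dot_le[of d \<theta> x] by linarith+
  have m: "?u \<in> borel_measurable (leb d)" "(\<lambda>x. \<bar>?u x\<bar>) \<in> borel_measurable (leb d)"
    by measurable
  have i: "integrable (leb d) (\<lambda>x. ?u x * sgnp d s x)" "integrable (leb d) (\<lambda>x. \<bar>?u x\<bar> * sgnp d s x)"
    using integral_mu_minus_nu(3)[OF m(1) integrable_linear_growth[OF m(1) le(1)]]
      integral_mu_minus_nu(3)[OF m(2) integrable_linear_growth[OF m(2) le(2)]] .
  have "(\<integral>x. relu (?u x) * sgnp d s x \<partial>leb d) = (\<integral>x. (?u x * sgnp d s x + \<bar>?u x\<bar> * sgnp d s x) / 2 \<partial>leb d)"
    unfolding relu_eq by (intro Bochner_Integration.integral_cong refl) (simp add: field_simps)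
  also have "\<dots> = (\<integral>x. \<bar>?u x\<bar> * sgnp d s x \<partial>leb d) / 2"
    by (subst integral_divide_zero, subst Bochner_Integration.integral_add[OF i])
       (simp add: integral_affine_sgnp[OF d2])
  finally have "2 * \<bar>\<integral>x. relu (?u x) * sgnp d s x \<partial>leb d\<bar> = \<bar>\<integral>x. \<bar>?u x\<bar> * sgnp d s x \<partial>leb d\<bar>"
    by simp
  also have "\<dots> \<le> kappa ^ (d - 2) * enorm d \<theta> * sqrt (2 * pi) / s / absc"
    unfolding pos_le_divide_eq[OF absc_pos]
    using abs_neuron_sgnp_le[OF d2, of \<theta> b] by (subst mult.commute)
  finally show ?thesis .
qed

end

text \<open>Subtracting the constant \<open>relu (- b)\<close> changes nothing, since
  \<open>sgnp\<close> has integral 0. As \<open>relu\<close> is 1-Lipschitz, the first absolute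
  moment then bounds the integral uniformly in \<open>b\<close>.\<close>

lemma neuron_sgnp_le_1:
  assumes s: "s > 0"
  shows "\<bar>\<integral>x. relu (dot 1 \<theta> x - b) * sgnp 1 s x \<partial>leb 1\<bar>
    \<le> enorm 1 \<theta> * (\<integral>x. \<bar>x 1\<bar> * mixp 1 s x \<partial>leb 1)"
proof -
  have i1: "integrable (leb 1) (\<lambda>x. relu (dot 1 \<theta> x - b) * sgnp 1 s x)"
    using integral_mu_minus_nu(3)[OF _ integrable_neuron[OF s]] by simp
  have "(\<integral>x. relu (dot 1 \<theta> x - b) * sgnp 1 s x \<partial>leb 1)
     = (\<integral>x. relu (dot 1 \<theta> x - b) * sgnp 1 s x \<partial>leb 1) - relu (- b) * integral\<^sup>L (leb 1) (sgnp 1 s)"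
    by (simp add: integral_sgnp[OF s])
  also have "\<dots> = (\<integral>x. (relu (dot 1 \<theta> x - b) - relu (- b)) * sgnp 1 s x \<partial>leb 1)"
    unfolding left_diff_distrib using i1 integral_sgnp(1)[OF s]
    by (subst Bochner_Integration.integral_diff) auto
  also have "norm \<dots> \<le> (\<integral>x. enorm 1 \<theta> * (\<bar>x 1\<bar> * mixp 1 s x) \<partial>leb 1)"
  proof (rule order_trans[OF integral_norm_bound integral_mono])
    show "integrable (leb 1) (\<lambda>x. norm ((relu (dot 1 \<theta> x - b) - relu (- b)) * sgnp 1 s x))"
      unfolding left_diff_distrib using i1 integral_sgnp(1)[OF s] by (intro integrable_norm) auto
    show "integrable (leb 1) (\<lambda>x. enorm 1 \<theta> * (\<bar>x 1\<bar> * mixp 1 s x))"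
      using integrable_component_mixp[OF s, of 1 1] by simp
    fix x :: "nat \<Rightarrow> real"
    have "\<bar>relu (dot 1 \<theta> x - b) - relu (- b)\<bar> \<le> \<bar>dot 1 \<theta> x\<bar>"
      unfolding relu_def by linarith
    also have "\<dots> = \<bar>\<theta> 1\<bar> * \<bar>x 1\<bar>" by (simp add: dot_def abs_mult)
    also have "\<dots> \<le> enorm 1 \<theta> * \<bar>x 1\<bar>" using abs_le_enorm[of 1 1 \<theta>] by (simp add: mult_right_mono)
    finally have "\<bar>relu (dot 1 \<theta> x - b) - relu (- b)\<bar> * \<bar>sgnp 1 s x\<bar> \<le> (enorm 1 \<theta> * \<bar>x 1\<bar>) * mixp 1 s x"
      by (intro mult_mono abs_sgnp_le) auto
    then show "norm ((relu (dot 1 \<theta> x - b) - relu (- b)) * sgnp 1 s x) \<le> enorm 1 \<theta> * (\<bar>x 1\<bar> * mixp 1 s x)"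
      by (simp add: abs_mult mult.assoc)
  qed
  finally show ?thesis by simp
qed

lemma neuron_bound:
  obtains C where "C > 0" "\<And>d \<theta> b. d \<ge> 1 \<Longrightarrow>
    2 * \<bar>\<integral>x. relu (dot d \<theta> x - b) * sgnp d (sd d) x \<partial>leb d\<bar> \<le> C * kappa ^ d * (real d)\<^sup>2 * enorm d \<theta>"
proof -
  define M where "M = (\<integral>x. \<bar>x 1\<bar> * mixp 1 (sd 1) x \<partial>leb 1)"
  have M: "M \<ge> 0" unfolding M_def mixp_def
    by (intro Bochner_Integration.integral_nonneg mult_nonneg_nonneg prod_nonneg) (auto intro: mixd_nonneg)
  \<comment> \<open>The first entry serves \<open>d = 1\<close>. The second serves
    \<open>d \<ge> 2\<close>: the 64 comes from \<open>inverse_sd_le\<close>, and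
    \<open>kappa\<^sup>2\<close> makes up for the exponent \<open>d - 2\<close>.\<close>
  define C where "C = max (2 * M / kappa) (64 / (kappa\<^sup>2 * absc))"
  have C: "2 * M / kappa \<le> C" "64 / (kappa\<^sup>2 * absc) \<le> C" unfolding C_def by auto
  show ?thesis
  proof
    show Cpos: "C > 0" by (rule less_le_trans[OF _ C(2)]) (use kappa_pos absc_pos in simp)
    fix d :: nat and \<theta> b
    assume d: "d \<ge> 1"
    show "2 * \<bar>\<integral>x. relu (dot d \<theta> x - b) * sgnp d (sd d) x \<partial>leb d\<bar> \<le> C * kappa ^ d * (real d)\<^sup>2 * enorm d \<theta>"
    proof (cases "d = 1")
      case True
      have "2 * \<bar>\<integral>x. relu (dot 1 \<theta> x - b) * sgnp 1 (sd 1) x \<partial>leb 1\<bar> \<le> 2 * (enorm 1 \<theta> * M)"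
        using neuron_sgnp_le_1[OF sd_pos, of 1 \<theta> b] unfolding M_def by simp
      also have "\<dots> = (2 * M / kappa) * kappa * enorm 1 \<theta>" using kappa_pos by simp
      also have "\<dots> \<le> C * kappa * enorm 1 \<theta>"
        using C(1) kappa_pos by (intro mult_right_mono) auto
      finally show ?thesis using True by simp
    next
      case False
      then have d2: "d \<ge> 2" using d by simp
      have "2 * \<bar>\<integral>x. relu (dot d \<theta> x - b) * sgnp d (sd d) x \<partial>leb d\<bar>
          \<le> kappa ^ (d - 2) * enorm d \<theta> * sqrt (2 * pi) / sd d / absc"
        by (rule neuron_sgnp_le[OF sd_pos d d2]) fact
      also have "\<dots> = kappa ^ (d - 2) * enorm d \<theta> * sqrt (2 * pi) / absc * (1 / sd d)"
        by simp
      also have "\<dots> \<le> kappa ^ (d - 2) * enorm d \<theta> * sqrt (2 * pi) / absc * (64 * real d / sqrt (2 * pi))"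
        using kappa_pos absc_pos by (intro mult_left_mono inverse_sd_le d) auto
      also have "\<dots> = 64 / (kappa\<^sup>2 * absc) * (kappa\<^sup>2 * kappa ^ (d - 2)) * real d * enorm d \<theta>"
        using kappa_pos by simp
      also have "kappa\<^sup>2 * kappa ^ (d - 2) = kappa ^ d"
        by (simp only: power_add[symmetric] le_add_diff_inverse[OF d2])
      \<comment> \<open>The factor \<open>real d\<close> coming from \<open>1 / sd d\<close> is
        enlarged to its square.\<close>
      also have "64 / (kappa\<^sup>2 * absc) * kappa ^ d * real d * enorm d \<theta> \<le> C * kappa ^ d * (real d)\<^sup>2 * enorm d \<theta>"
        using C Cpos d kappa_pos absc_pos self_le_power[of "real d" 2]
        by (intro mult_right_mono mult_mono) auto
      finally show ?thesis .
    qed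
  qed
qed

text \<open>The difference of expectations is linear in the neurons. The bias \<open>w 0\<close>
  cancels between two probability measures, and summing the neuron bounds reproduces the
  path-norm.\<close>

lemma F2L_upper_bound:
  obtains C :: real where "C > 0"
    "\<And>d. d \<ge> 1 \<Longrightarrow> ipm (F2L d) (mu d (sd d)) (nu d (sd d)) \<le> ereal (C * kappa ^ d * (real d)\<^sup>2)"
proof -
  obtain C where C: "C > 0" "\<And>d \<theta> b. d \<ge> 1 \<Longrightarrow>
    2 * \<bar>\<integral>x. relu (dot d \<theta> x - b) * sgnp d (sd d) x \<partial>leb d\<bar> \<le> C * kappa ^ d * (real d)\<^sup>2 * enorm d \<theta>"
    by (rule neuron_bound) blast
  show ?thesis
  proof
    fix d :: nat assume d: "d \<ge> 1"
    note s = sd_pos[OF d]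
    let ?K = "C * kappa ^ d * (real d)\<^sup>2"
    have K: "?K \<ge> 0" using C(1) kappa_pos by simp
    interpret M: prob_space "mu d (sd d)" by (rule prob_space_mu_nu[OF s d])
    interpret N: prob_space "nu d (sd d)" by (rule prob_space_mu_nu[OF s d])
    show "ipm (F2L d) (mu d (sd d)) (nu d (sd d)) \<le> ereal ?K"
      unfolding ipm_def
    proof (rule SUP_least)
      fix f assume "f \<in> F2L d"
      then obtain m \<theta> b w where f: "f = net2 d m \<theta> b w" and pn: "path_norm2 d m \<theta> w \<le> 1"
        unfolding F2L_def by blast
      let ?g = "\<lambda>i x. relu (dot d (\<theta> i) x - b i)"
      have m: "?g i \<in> borel_measurable (leb d)" for i by measurable
      note g = integral_mu_minus_nu[OF m integrable_neuron[OF s d]]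
      have "integral\<^sup>L (mu d (sd d)) f = (\<Sum>i=1..m. w i * integral\<^sup>L (mu d (sd d)) (?g i)) + w 0"
        unfolding f net2_def using g(1) by (simp add: M.prob_space)
      moreover have "integral\<^sup>L (nu d (sd d)) f = (\<Sum>i=1..m. w i * integral\<^sup>L (nu d (sd d)) (?g i)) + w 0"
        unfolding f net2_def using g(2) by (simp add: N.prob_space)
      ultimately have "integral\<^sup>L (mu d (sd d)) f - integral\<^sup>L (nu d (sd d)) f
          = (\<Sum>i=1..m. w i * (integral\<^sup>L (mu d (sd d)) (?g i) - integral\<^sup>L (nu d (sd d)) (?g i)))"
        by (simp add: right_diff_distrib sum_subtractf)
      also have "\<dots> = (\<Sum>i=1..m. w i * (2 * (\<integral>x. ?g i x * sgnp d (sd d) x \<partial>leb d)))"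
        unfolding g(4) ..
      also have "\<bar>\<dots>\<bar> \<le> (\<Sum>i=1..m. \<bar>w i\<bar> * (?K * enorm d (\<theta> i)))"
        using C(2)[OF d] by (intro order_trans[OF sum_abs] sum_mono) (auto simp: abs_mult intro!: mult_left_mono)
      also have "\<dots> = ?K * path_norm2 d m \<theta> w"
        unfolding path_norm2_def by (simp add: sum_distrib_left mult_ac)
      also have "\<dots> \<le> ?K" using mult_left_mono[OF pn K] by simp
      finally show "ereal \<bar>integral\<^sup>L (mu d (sd d)) f - integral\<^sup>L (nu d (sd d)) f\<bar> \<le> ereal ?K" by simp
    qed
  qed (fact C(1))
qed

section \<open>Three-layer networks\<close>

lemma integrable_normal_density_indicator:
  assumes "s > 0" and [measurable]: "S \<in> sets borel"
  shows "integrable lborel (\<lambda>x. normal_density \<beta> s x * indicator S x)"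
  using integrable_normal_density[OF assms(1), of \<beta>]
  by (rule Bochner_Integration.integrable_bound) (auto simp: normal_density_nonneg indicator_def)

text \<open>Mills' argument: on \<open>{a..}\<close> the factor \<open>x / a\<close> is at least 1,
  and it gives the density an explicit antiderivative.\<close>

lemma normal_density_upper_tail:
  assumes s: "s > 0" and a: "a > 0"
  shows "(\<integral>x. normal_density 0 s x * indicator {a..} x \<partial>lborel) \<le> s / (a * sqrt (2 * pi)) * exp (- a\<^sup>2 / (2 * s\<^sup>2))"
    (is "_ \<le> ?R")
proof -
  let ?n = "normal_density 0 s"
  have R: "?R = 0 - (- (s\<^sup>2 / a * ?n a))"
    using s by (simp add: normal_density_def real_sqrt_mult power2_eq_square)
  have int: "integrable lborel (\<lambda>x. ?n x * indicator {a..} x)"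
    using s by (rule integrable_normal_density_indicator) simp
  have "ennreal (\<integral>x. ?n x * indicator {a..} x \<partial>lborel) = (\<integral>\<^sup>+x. ennreal (?n x * indicator {a..} x) \<partial>lborel)"
    using int by (intro nn_integral_eq_integral[symmetric]) (auto simp: normal_density_nonneg)
  also have "\<dots> \<le> (\<integral>\<^sup>+x. ennreal (x / a * ?n x) * indicator {a..} x \<partial>lborel)"
  proof (intro nn_integral_mono)
    fix x
    show "ennreal (?n x * indicator {a..} x) \<le> ennreal (x / a * ?n x) * indicator {a..} x"
    proof (cases "x \<in> {a..}")
      case True
      then have "1 * ?n x \<le> x / a * ?n x"
        using a by (intro mult_right_mono) (auto simp: normal_density_nonneg)
      then show ?thesis using True by (simp add: ennreal_leI)
    qed simp
  qed
  also have "\<dots> = ennreal (0 - (- (s\<^sup>2 / a * ?n a)))"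
  proof (rule nn_integral_FTC_atLeast[where F = "\<lambda>x. - (s\<^sup>2 / a * ?n x)"])
    show "DERIV (\<lambda>x. - (s\<^sup>2 / a * ?n x)) x :> x / a * ?n x" for x
      unfolding normal_density_def using s a
      by (auto intro!: derivative_eq_intros simp: field_simps power2_eq_square)
    show "0 \<le> x / a * ?n x" if "a \<le> x" for x
      using that a by (simp add: normal_density_nonneg)
    have "((\<lambda>x. - (s\<^sup>2 / a * (1 / sqrt (2 * pi * s\<^sup>2) * exp (- (x\<^sup>2 / (2 * s\<^sup>2)))))) \<longlongrightarrow> - (s\<^sup>2 / a * (1 / sqrt (2 * pi * s\<^sup>2) * 0))) at_top"
    proof (intro tendsto_intros)
      have "filterlim (\<lambda>x::real. x\<^sup>2 / (2 * s\<^sup>2)) at_top at_top"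
        unfolding divide_inverse using s
        by (intro filterlim_at_top_mult_tendsto_pos[OF tendsto_const] filterlim_pow_at_top filterlim_ident) auto
      then show "((\<lambda>x. exp (- (x\<^sup>2 / (2 * s\<^sup>2)))) \<longlongrightarrow> 0) at_top"
        by (intro filterlim_compose[OF exp_at_bot] filterlim_compose[OF filterlim_uminus_at_bot_at_top])
    qed
    then show "((\<lambda>x. - (s\<^sup>2 / a * ?n x)) \<longlongrightarrow> 0) at_top"
      by (simp add: normal_density_def)
  qed measurable
  finally show ?thesis
    unfolding R using a by (subst (asm) ennreal_le_iff) (auto simp: normal_density_nonneg)
qed

lemma normal_density_tail:
  assumes s: "s > 0" and a: "a > 0"
  shows "(\<integral>x. normal_density \<beta> s x * indicator {x. \<bar>x - \<beta>\<bar> > a} x \<partial>lborel)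
    \<le> 2 * (s / (a * sqrt (2 * pi)) * exp (- a\<^sup>2 / (2 * s\<^sup>2)))"
proof -
  let ?n = "normal_density \<beta> s"
  have side: "(\<integral>x. ?n x * indicator {a..} (c * (x - \<beta>)) \<partial>lborel) = (\<integral>x. normal_density 0 s x * indicator {a..} x \<partial>lborel)"
    if "c = 1 \<or> c = -1" for c
    using that
    by (subst lborel_integral_real_affine[where c=c and t=\<beta>]) (auto simp: normal_density_def)
  note int = integrable_normal_density_indicator[OF s]
  have m: "{x. a \<le> c * (x - \<beta>)} \<in> sets borel" for c by measurable
  have i: "integrable lborel (\<lambda>x. ?n x * indicator {a..} (c * (x - \<beta>)))" for c
    using int[OF m[of c], of \<beta>] by (simp add: indicator_def)
  have "(\<integral>x. ?n x * indicator {x. \<bar>x - \<beta>\<bar> > a} x \<partial>lborel)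
      \<le> (\<integral>x. ?n x * indicator {a..} (1 * (x - \<beta>)) + ?n x * indicator {a..} ((-1) * (x - \<beta>)) \<partial>lborel)"
    by (intro integral_mono int Bochner_Integration.integrable_add i)
       (auto simp: normal_density_nonneg indicator_def)
  also have "\<dots> = 2 * (\<integral>x. normal_density 0 s x * indicator {a..} x \<partial>lborel)"
    by (subst Bochner_Integration.integral_add[OF i i]) (use side[of 1] side[of "-1"] in simp)
  finally show ?thesis using normal_density_upper_tail[OF s a] by simp
qed

text \<open>The defining equation of \<open>sd d\<close> turns the exponential in the tail bound
  into the reciprocal of the argument of the logarithm. Everything but
  \<open>2 * \<epsilon> / d\<close> cancels, with \<open>\<epsilon> = 1/8\<close>.\<close>

lemma sd_tail:
  assumes d: "d \<ge> 1"
  shows "(\<integral>x. normal_density \<beta> (sd d) x * indicator {x. \<bar>x - \<beta>\<bar> > 1/8} x \<partial>lborel) \<le> 1 / (4 * real d)"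
proof -
  note s = sd_pos[OF d]
  define y where "y = real d * sd d / (sqrt (2 * pi) * (1/8) * (1/8))"
  have y: "y > 0" unfolding y_def using s d by simp
  have "exp (- (1/8)\<^sup>2 / (2 * (sd d)\<^sup>2)) = exp (- ln y)"
    using sd_eq_sd[OF d] unfolding sd_eq_def y_def by simp
  also have "\<dots> = 1 / y" using y by (simp add: exp_minus inverse_eq_divide)
  finally have "2 * (sd d / (1/8 * sqrt (2 * pi)) * exp (- (1/8)\<^sup>2 / (2 * (sd d)\<^sup>2))) = 1 / (4 * real d)"
    unfolding y_def using s d by (simp add: field_simps)
  with normal_density_tail[OF s, of "1/8" \<beta>] show ?thesis by simp
qed

text \<open>The part of the mixture in which a coordinate has left the interval of radius \<open>1/8\<close>
  around its centre, so that its sign may be wrong.\<close>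

definition misd :: "real \<Rightarrow> real \<Rightarrow> real" where
  "misd s x = (\<Sum>\<beta>\<in>B. normal_density \<beta> s x * indicator {x. \<bar>x - \<beta>\<bar> > 1/8} x) / 4"

lemma integrable_misd:
  assumes "s > 0"
  shows "integrable lborel (misd s)"
  unfolding misd_def using assms
  by (intro integrable_divide_zero Bochner_Integration.integrable_sum integrable_normal_density_indicator) measurable

lemma integral_misd_le:
  assumes d: "d \<ge> 1"
  shows "integral\<^sup>L lborel (misd (sd d)) \<le> 1 / (4 * real d)"
proof -
  have i: "integrable lborel (\<lambda>x. normal_density \<beta> (sd d) x * indicator {x. \<bar>x - \<beta>\<bar> > 1/8} x)" for \<beta>
    by (intro integrable_normal_density_indicator sd_pos d) measurable
  have "integral\<^sup>L lborel (misd (sd d))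
      = (\<Sum>\<beta>\<in>B. \<integral>x. normal_density \<beta> (sd d) x * indicator {x. \<bar>x - \<beta>\<bar> > 1/8} x \<partial>lborel) / 4"
    unfolding misd_def by (subst integral_divide_zero, subst Bochner_Integration.integral_sum[OF i]) auto
  also have "\<dots> \<le> (\<Sum>\<beta>\<in>B. 1 / (4 * real d)) / 4"
    by (intro divide_right_mono sum_mono sd_tail d) auto
  also have "\<dots> = 1 / (4 * real d)" unfolding sum_B by simp
  finally show ?thesis .
qed

text \<open>Outside the strip of half-width \<open>1/4\<close>, \<open>negstep\<close> detects the
  sign exactly. Points within \<open>1/8\<close> of a centre lie there, since centres have modulus
  at least \<open>1/2\<close>.\<close>

definition away :: "real \<Rightarrow> real" where
  "away x = indicator {x. \<bar>x\<bar> \<ge> 1/4} x"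

lemma away_measurable [measurable]: "away \<in> borel_measurable borel"
  unfolding away_def by measurable

text \<open>The comparison is made centre by centre. Within \<open>1/8\<close> of the centre both
  indicators and signs are right; elsewhere the signed term may drop from \<open>n\<close> to
  \<open>-n\<close>, which costs twice the density \<open>n\<close>, while the unsigned term drops
  at most to 0.\<close>

lemma away_sgnd_ge: "away x * sgn x * sgnd s x \<ge> mixd s x - 2 * misd s x"
  and away_mixd_ge: "away x * mixd s x \<ge> mixd s x - misd s x"
proof -
  let ?n = "\<lambda>\<beta>. normal_density \<beta> s x" and ?i = "\<lambda>\<beta>. indicator {x. \<bar>x - \<beta>\<bar> > 1/8} x :: real"
  have 1: "?n \<beta> - 2 * (?n \<beta> * ?i \<beta>) \<le> away x * sgn x * (sgn \<beta> * ?n \<beta>)" if "\<beta> \<in> B" for \<beta>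
  proof -
    have "1 - 2 * ?i \<beta> \<le> away x * sgn x * sgn \<beta>"
      using that unfolding B_def away_def by (auto simp: indicator_def sgn_if)
    from mult_right_mono[OF this normal_density_nonneg[of \<beta> s x]] show ?thesis
      by (simp add: algebra_simps)
  qed
  have 2: "?n \<beta> - ?n \<beta> * ?i \<beta> \<le> away x * ?n \<beta>" if "\<beta> \<in> B" for \<beta>
  proof -
    have "1/2 \<le> \<bar>\<beta>\<bar>" using that by (auto simp: B_def)
    then have "\<bar>x - \<beta>\<bar> > 1/8 \<or> 1/4 \<le> \<bar>x\<bar>" by linarith
    then have "1 - ?i \<beta> \<le> away x"
      by (auto simp: away_def indicator_def)
    from mult_right_mono[OF this normal_density_nonneg[of \<beta> s x]] show ?thesis
      by (simp add: algebra_simps)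
  qed
  have "(\<Sum>\<beta>\<in>B. ?n \<beta> - 2 * (?n \<beta> * ?i \<beta>)) \<le> (\<Sum>\<beta>\<in>B. away x * sgn x * (sgn \<beta> * ?n \<beta>))"
    by (intro sum_mono 1)
  then show "away x * sgn x * sgnd s x \<ge> mixd s x - 2 * misd s x"
    unfolding mixd_def sgnd_def misd_def sum_subtractf sum_distrib_left[symmetric]
    by linarith
  have "(\<Sum>\<beta>\<in>B. ?n \<beta> - ?n \<beta> * ?i \<beta>) \<le> (\<Sum>\<beta>\<in>B. away x * ?n \<beta>)"
    by (intro sum_mono 2)
  then show "away x * mixd s x \<ge> mixd s x - misd s x"
    unfolding mixd_def misd_def sum_subtractf sum_distrib_left[symmetric]
    by linarith
qed

lemma integrable_away:
  assumes "s > 0"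
  shows "integrable lborel (\<lambda>x. away x * sgn x * sgnd s x)" "integrable lborel (\<lambda>x. away x * mixd s x)"
proof -
  show "integrable lborel (\<lambda>x. away x * sgn x * sgnd s x)"
    by (rule Bochner_Integration.integrable_bound[OF sgnd_integrable[OF assms]])
       (auto simp: abs_mult away_def indicator_def sgn_if)
  show "integrable lborel (\<lambda>x. away x * mixd s x)"
    by (rule Bochner_Integration.integrable_bound[OF mixd_integrable[OF assms]])
       (auto simp: abs_mult away_def indicator_def)
qed

lemma integral_away_ge:
  assumes d: "d \<ge> 1"
  shows "1 - 1 / (2 * real d) \<le> (\<integral>x. away x * sgn x * sgnd (sd d) x \<partial>lborel)"
    and "1 - 1 / (4 * real d) \<le> (\<integral>x. away x * mixd (sd d) x \<partial>lborel)"
proof -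
  note s = sd_pos[OF d]
  have "1 - 1 / (2 * real d) \<le> 1 - 2 * integral\<^sup>L lborel (misd (sd d))"
    using integral_misd_le[OF d] by simp
  also have "\<dots> = (\<integral>x. mixd (sd d) x - 2 * misd (sd d) x \<partial>lborel)"
    using s integrable_misd[OF s] by simp
  also have "\<dots> \<le> (\<integral>x. away x * sgn x * sgnd (sd d) x \<partial>lborel)"
    using s by (intro integral_mono Bochner_Integration.integrable_diff integrable_mult_right
        mixd_integrable integrable_misd integrable_away away_sgnd_ge)
  finally show "1 - 1 / (2 * real d) \<le> (\<integral>x. away x * sgn x * sgnd (sd d) x \<partial>lborel)" .
  have "1 - 1 / (4 * real d) \<le> 1 - integral\<^sup>L lborel (misd (sd d))"
    using integral_misd_le[OF d] by simp
  also have "\<dots> = (\<integral>x. mixd (sd d) x - misd (sd d) x \<partial>lborel)"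
    using s integrable_misd[OF s] by simp
  also have "\<dots> \<le> (\<integral>x. away x * mixd (sd d) x \<partial>lborel)"
    using s by (intro integral_mono Bochner_Integration.integrable_diff
        mixd_integrable integrable_misd integrable_away away_mixd_ge)
  finally show "1 - 1 / (4 * real d) \<le> (\<integral>x. away x * mixd (sd d) x \<partial>lborel)" .
qed

text \<open>Nothing but boundedness is known of \<open>f\<close> inside the strips. The lower bound
  for \<open>f * sgnp\<close> is therefore assembled from product functions, whose integrals
  factorise.\<close>

lemma sign_test_gap:
  assumes d: "d \<ge> 1" and f: "f \<in> borel_measurable (leb d)" and bd: "\<And>x. \<bar>f x\<bar> \<le> 1"
    and sgn: "\<And>x. (\<And>i. i \<in> {1..d} \<Longrightarrow> 1/4 \<le> \<bar>x i\<bar>) \<Longrightarrow> f x = (\<Prod>i=1..d. sgn (x i))"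
  shows "1 / 2 \<le> integral\<^sup>L (mu d (sd d)) f - integral\<^sup>L (nu d (sd d)) f"
proof -
  define s where "s = sd d"
  have s: "s > 0" unfolding s_def by (rule sd_pos[OF d])
  have mixp_nonneg: "mixp d s x \<ge> 0" for x
    unfolding mixp_def by (intro prod_nonneg) (auto intro: mixd_nonneg)
  have int: "integrable (leb d) (\<lambda>x. f x * mixp d s x)"
  proof (rule Bochner_Integration.integrable_bound[OF integrable_mixp[OF s d]])
    show "AE x in leb d. norm (f x * mixp d s x) \<le> norm (mixp d s x)"
      using bd by (intro AE_I2) (simp add: abs_mult mult_left_le_one_le)
  qed (use f in measurable)
  let ?a = "\<lambda>x. \<Prod>i=1..d. away (x i) * sgn (x i) * sgnd s (x i)"
  let ?b = "\<lambda>x. \<Prod>i=1..d. away (x i) * mixd s (x i)"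
  have ia: "integrable (leb d) ?a" and ib: "integrable (leb d) ?b"
    by (intro leb_integrable_prod integrable_away s)+
  \<comment> \<open>Outside all strips \<open>?b\<close> equals \<open>mixp\<close> and equality
    holds. Inside some strip \<open>?a\<close> and \<open>?b\<close> vanish, and what remains is the
    trivial bound \<open>- mixp\<close>.\<close>
  have le: "?a x + ?b x - mixp d s x \<le> f x * sgnp d s x" for x
  proof (cases "\<forall>i\<in>{1..d}. 1/4 \<le> \<bar>x i\<bar>")
    case True
    then have w: "away (x i) = 1" if "i \<in> {1..d}" for i using that by (auto simp: away_def)
    then have "?a x = (\<Prod>i=1..d. sgn (x i) * sgnd s (x i))" "?b x = mixp d s x"
      unfolding mixp_def by (auto intro!: prod.cong)
    moreover have "f x * sgnp d s x = (\<Prod>i=1..d. sgn (x i) * sgnd s (x i))"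
      using sgn[of x] True by (simp only: prod.distrib sgnp_def)
    ultimately show ?thesis by simp
  next
    case False
    then obtain i where i: "i \<in> {1..d}" "\<not> 1/4 \<le> \<bar>x i\<bar>" by blast
    then have "away (x i) = 0" by (simp add: away_def)
    with i have "\<exists>i\<in>{1..d}. away (x i) = 0" by blast
    then have "?a x = 0" "?b x = 0" by (auto intro!: prod_zero)
    moreover have "\<bar>f x * sgnp d s x\<bar> \<le> 1 * mixp d s x"
      unfolding abs_mult by (intro mult_mono bd abs_sgnp_le) auto
    ultimately show ?thesis by linarith
  qed
  \<comment> \<open>By Bernoulli's inequality, \<open>d\<close> factors that each lose at most
    \<open>1 / (2 * d)\<close> lose at most \<open>1/2\<close> in total; likewise \<open>1/4\<close>
    for \<open>?b\<close>.\<close>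
  have "1 - real d * (1 / (2 * real d)) \<le> (1 - 1 / (2 * real d)) ^ d"
    using Bernoulli_inequality[of "- (1 / (2 * real d))" d] d by (simp add: field_simps)
  also have "\<dots> \<le> (\<integral>x. away x * sgn x * sgnd s x \<partial>lborel) ^ d"
    unfolding s_def using d by (intro power_mono integral_away_ge) (auto simp: field_simps)
  also have "\<dots> = integral\<^sup>L (leb d) ?a"
    by (subst leb_integral_prod) (auto intro: integrable_away s)
  finally have a: "1 / 2 \<le> integral\<^sup>L (leb d) ?a" using d by simp
  have "1 - real d * (1 / (4 * real d)) \<le> (1 - 1 / (4 * real d)) ^ d"
    using Bernoulli_inequality[of "- (1 / (4 * real d))" d] d by (simp add: field_simps)
  also have "\<dots> \<le> (\<integral>x. away x * mixd s x \<partial>lborel) ^ d"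
    unfolding s_def using d by (intro power_mono integral_away_ge) (auto simp: field_simps)
  also have "\<dots> = integral\<^sup>L (leb d) ?b"
    by (subst leb_integral_prod) (auto intro: integrable_away s)
  finally have b: "3 / 4 \<le> integral\<^sup>L (leb d) ?b" using d by simp
  have m: "integral\<^sup>L (leb d) (mixp d s) = 1"
    unfolding mixp_def using s leb_integral_prod[of d "\<lambda>_. mixd s"] by simp
  note im = integrable_mixp[OF s d]
  \<comment> \<open>The value is \<open>1/2 + 3/4 - 1\<close>; the factor 2 in
    \<open>integral_mu_minus_nu\<close> doubles it.\<close>
  have "1 / 4 \<le> integral\<^sup>L (leb d) ?a + integral\<^sup>L (leb d) ?b - integral\<^sup>L (leb d) (mixp d s)"
    using a b m by simp
  also have "\<dots> = (\<integral>x. ?a x + ?b x - mixp d s x \<partial>leb d)"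
    using ia ib im by simp
  also have "\<dots> \<le> (\<integral>x. f x * sgnp d s x \<partial>leb d)"
    using ia ib im integral_mu_minus_nu(3)[OF f int] le by (intro integral_mono) auto
  finally show ?thesis using integral_mu_minus_nu(4)[OF f int] unfolding s_def by simp
qed

section \<open>The network computing the parity of the signs\<close>

definition zigzag :: "nat \<Rightarrow> real \<Rightarrow> real" where
  "zigzag n S = 1 - 2 * relu S + 4 * (\<Sum>k=1..n. (-1) ^ Suc k * relu (S - real k))"

lemma zigzag_Suc: "zigzag (Suc n) S = zigzag n S + 4 * (-1) ^ n * relu (S - real (Suc n))"
  unfolding zigzag_def by (simp add: algebra_simps)

text \<open>On the nonnegative axis the slope starts at -2, and each kink changes it by 4 in
  alternating directions, so it alternates between -2 and 2. Past the last kink the final linear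
  piece continues.\<close>

lemma zigzag_beyond: "real n \<le> S \<Longrightarrow> zigzag n S = (-1) ^ n * (1 - 2 * (S - real n))"
proof (induction n)
  case 0
  then show ?case by (simp add: zigzag_def relu_def)
next
  case (Suc n)
  then show ?case unfolding zigzag_Suc by (simp add: relu_def algebra_simps)
qed

lemma zigzag_Suc_below: "S \<le> real (Suc n) \<Longrightarrow> zigzag (Suc n) S = zigzag n S"
  unfolding zigzag_Suc by (simp add: relu_def)

lemma abs_zigzag_le: "0 \<le> S \<Longrightarrow> S \<le> real n \<Longrightarrow> \<bar>zigzag n S\<bar> \<le> 1"
proof (induction n)
  case 0
  then show ?case by (simp add: zigzag_def relu_def)
next
  case (Suc n)
  then have eq: "zigzag (Suc n) S = zigzag n S" by (simp add: zigzag_Suc_below)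
  show ?case
  proof (cases "S \<le> real n")
    case True
    then show ?thesis using Suc eq by simp
  next
    case False
    then have "zigzag n S = (-1) ^ n * (1 - 2 * (S - real n))" by (intro zigzag_beyond) simp
    then have "\<bar>zigzag n S\<bar> = \<bar>1 - 2 * (S - real n)\<bar>" by (simp add: abs_mult power_abs)
    then show ?thesis using Suc.prems False eq by simp
  qed
qed

lemma zigzag_of_nat: "j \<le> n \<Longrightarrow> zigzag n (real j) = (-1) ^ j"
proof (induction n)
  case 0
  then show ?case by (simp add: zigzag_def relu_def)
next
  case (Suc n)
  show ?case
  proof (cases "j \<le> n")
    case True
    then show ?thesis using Suc by (simp add: zigzag_Suc_below)
  next
    case False
    then have "j = Suc n" using Suc.prems by simp
    then show ?thesis using zigzag_beyond[of "Suc n" "real (Suc n)"] by simp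
  qed
qed

text \<open>A ramp falling from 1 to 0 across \<open>[-1/4, 1/4]\<close>, built from two
  neurons.\<close>

definition negstep :: "real \<Rightarrow> real" where
  "negstep y = 2 * (relu (- y + 1/4) - relu (- y - 1/4))"

lemma negstep_bounds: "0 \<le> negstep y" "negstep y \<le> 1"
  by (auto simp: negstep_def relu_def max_def)

lemma negstep_away: "1/4 \<le> \<bar>y\<bar> \<Longrightarrow> negstep y = (if y < 0 then 1 else 0)"
  by (auto simp: negstep_def relu_def)

lemma negstep_measurable [measurable]: "negstep \<in> borel_measurable borel"
  unfolding negstep_def by measurable

lemma zigzag_measurable [measurable]: "zigzag n \<in> borel_measurable borel"
  unfolding zigzag_def by measurable

text \<open>The witness \<open>n\<close> is the number of negative coordinates: each adds 1 to the
  sum and a factor -1 to the product.\<close>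

lemma sum_negstep_parity:
  assumes "finite I" "\<And>i. i \<in> I \<Longrightarrow> 1/4 \<le> \<bar>x i\<bar>"
  shows "\<exists>n\<le>card I. (\<Sum>i\<in>I. negstep (x i)) = real n \<and> (\<Prod>i\<in>I. sgn (x i)) = (-1) ^ n"
  using assms
proof (induction I rule: finite_induct)
  case empty
  then show ?case by auto
next
  case (insert i I)
  then obtain n where n: "n \<le> card I" "(\<Sum>i\<in>I. negstep (x i)) = real n" "(\<Prod>i\<in>I. sgn (x i)) = (-1) ^ n"
    by auto
  have i: "1/4 \<le> \<bar>x i\<bar>" using insert by simp
  show ?case
  proof (cases "x i < 0")
    case True
    then show ?thesis
      using n insert.hyps by (intro exI[of _ "Suc n"]) (auto simp: negstep_away[OF i])
  next
    case False
    then have "x i > 0" using i by linarith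
    then show ?thesis
      using n insert.hyps by (intro exI[of _ n]) (auto simp: negstep_away[OF i])
  qed
qed

definition parity_net :: "nat \<Rightarrow> (nat \<Rightarrow> real) \<Rightarrow> real" where
  "parity_net d x = zigzag d (\<Sum>i=1..d. negstep (x i))"

lemma parity_net_gap:
  assumes d: "d \<ge> 1"
  shows "1 / 2 \<le> integral\<^sup>L (mu d (sd d)) (parity_net d) - integral\<^sup>L (nu d (sd d)) (parity_net d)"
proof (rule sign_test_gap[OF d])
  show "parity_net d \<in> borel_measurable (leb d)"
    unfolding parity_net_def leb_def by measurable
  show "\<bar>parity_net d x\<bar> \<le> 1" for x
  proof -
    have "(\<Sum>i=1..d. negstep (x i)) \<le> (\<Sum>i=1..d. 1)" by (intro sum_mono negstep_bounds)
    then show ?thesis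
      unfolding parity_net_def by (intro abs_zigzag_le sum_nonneg) (auto simp: negstep_bounds)
  qed
  fix x :: "nat \<Rightarrow> real"
  assume "\<And>i. i \<in> {1..d} \<Longrightarrow> 1/4 \<le> \<bar>x i\<bar>"
  from sum_negstep_parity[of "{1..d}" x, OF _ this] obtain n
    where "n \<le> d" "(\<Sum>i=1..d. negstep (x i)) = real n" "(\<Prod>i=1..d. sgn (x i)) = (-1) ^ n"
    by auto
  then show "parity_net d x = (\<Prod>i=1..d. sgn (x i))"
    unfolding parity_net_def by (simp add: zigzag_of_nat)
qed

lemma parity_net_in_F3L:
  assumes d: "d \<ge> 1"
  shows "(\<lambda>x. parity_net d x / (24 * (real d)\<^sup>2 + 24 * real d + 1)) \<in> F3L d"
proof -
  define N where "N = 24 * (real d)\<^sup>2 + 24 * real d + 1"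
  have N: "N > 0" unfolding N_def by (simp add: add_nonneg_pos)
  \<comment> \<open>First-layer neurons \<open>j\<close> and \<open>j + d\<close> both read
    \<open>- x j\<close>; the thresholds in \<open>b\<close> make them the two halves of
    \<open>negstep (x j)\<close>.\<close>
  define \<theta> :: "nat \<Rightarrow> nat \<Rightarrow> real" where
    "\<theta> j i = (if i = (if j \<le> d then j else j - d) then -1 else 0)" for j i
  define b :: "nat \<Rightarrow> real" where "b j = (if j \<le> d then -1/4 else 1/4)" for j
  define W :: "nat \<Rightarrow> nat \<Rightarrow> real" where
    \<comment> \<open>All second-layer neurons receive the same sum of steps. Neuron
      \<open>i\<close> carries the kink at \<open>i - 1\<close>, hence the bias
      \<open>1 - real i\<close>.\<close>
    "W i j = (if j = 0 then 1 - real i else if j \<le> d then 2 else -2)" for i j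
  define w :: "nat \<Rightarrow> real" where
    \<comment> \<open>These are the coefficients of \<open>zigzag\<close>: the kink at
      \<open>k\<close> belongs to neuron \<open>i = Suc k\<close>, so its sign
      \<open>(-1) ^ Suc k\<close> reads \<open>(-1) ^ i\<close>.\<close>
    "w i = (if i = 0 then 1 else if i = 1 then -2 else 4 * (-1) ^ i) / N" for i
  have split: "(\<Sum>j=1..2*d. g j) = (\<Sum>j=1..d. g j) + (\<Sum>j=1..d. g (j + d))" for g :: "nat \<Rightarrow> real"
    using sum.ub_add_nat[of 1 d g d] sum.shift_bounds_cl_nat_ivl[of g 1 d d] by (simp add: mult_2)
  have dot: "dot d (\<theta> j) x = - x j" "dot d (\<theta> (j + d)) x = - x j" if "j \<in> {1..d}" for j x
    using that unfolding dot_def \<theta>_def by (simp_all add: if_distrib if_distribR sum.delta cong: if_cong)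
  have enorm: "(enorm d (\<theta> j))\<^sup>2 = 1" if "j \<in> {1..2*d}" for j
  proof -
    define k where "k = (if j \<le> d then j else j - d)"
    have "(enorm d (\<theta> j))\<^sup>2 = (\<Sum>i=1..d. (\<theta> j i)\<^sup>2)"
      by (simp add: enorm_def L2_set_def sum_nonneg)
    also have "\<dots> = (\<Sum>i=1..d. if i = k then 1 else 0)"
      by (intro sum.cong refl) (simp add: \<theta>_def k_def)
    also have "\<dots> = 1" using that by (subst sum.delta) (auto simp: k_def)
    finally show ?thesis .
  qed
  have inner: "(\<Sum>j=1..2*d. W i j * relu (dot d (\<theta> j) x - b j)) = (\<Sum>i=1..d. negstep (x i))" for i x
    unfolding split sum.distrib[symmetric]
    by (intro sum.cong refl) (simp add: dot W_def b_def negstep_def)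
  have "net3 d (2 * d) (Suc d) \<theta> b W w x = parity_net d x / N" for x
  proof -
    let ?S = "\<Sum>i=1..d. negstep (x i)"
    have "net3 d (2 * d) (Suc d) \<theta> b W w x = (\<Sum>i=1..Suc d. w i * relu (?S + (1 - real i))) + w 0"
      unfolding net3_def inner by (simp add: W_def)
    also have "(\<Sum>i=1..Suc d. w i * relu (?S + (1 - real i)))
        = w 1 * relu ?S + (\<Sum>i=1..d. w (Suc i) * relu (?S - real i))"
      by (subst sum.atLeast_Suc_atMost) (simp_all add: sum.shift_bounds_cl_Suc_ivl del: sum.cl_ivl_Suc)
    also have "\<dots> + w 0 = (1 - 2 * relu ?S + (\<Sum>i=1..d. 4 * (-1) ^ Suc i * relu (?S - real i))) / N"
      by (simp add: w_def add_divide_distrib diff_divide_distrib sum_divide_distrib)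
    finally show ?thesis
      unfolding parity_net_def zigzag_def by (simp add: sum_distrib_left mult.assoc)
  qed
  then have eq: "net3 d (2 * d) (Suc d) \<theta> b W w = (\<lambda>x. parity_net d x / N)" by auto
  have "path_norm3 d (2 * d) (Suc d) \<theta> b W w \<le> 1"
  proof -
    \<comment> \<open>Each first-layer neuron has norm at most \<open>5/4\<close> and outer weight
      2, so the \<open>2 * d\<close> terms sum to at most \<open>5 * d\<close>.\<close>
    have "sqrt (1 + (1/4)\<^sup>2) \<le> (5/4 :: real)" by (rule real_le_lsqrt) (auto simp: power2_eq_square)
    then have "\<bar>W i j\<bar> * sqrt ((enorm d (\<theta> j))\<^sup>2 + (b j)\<^sup>2) \<le> 5/2" if "j \<in> {1..2*d}" for i j
      using that unfolding enorm[OF that] by (auto simp: W_def b_def power2_eq_square)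
    then have "(\<Sum>j=1..2*d. \<bar>W i j\<bar> * sqrt ((enorm d (\<theta> j))\<^sup>2 + (b j)\<^sup>2)) \<le> (\<Sum>j=1..2*d. 5/2)" for i
      by (intro sum_mono)
    then have 1: "(\<Sum>j=1..2*d. \<bar>W i j\<bar> * sqrt ((enorm d (\<theta> j))\<^sup>2 + (b j)\<^sup>2)) \<le> 5 * real d" for i
      by simp
    have "\<bar>w i\<bar> * ((\<Sum>j=1..2*d. \<bar>W i j\<bar> * sqrt ((enorm d (\<theta> j))\<^sup>2 + (b j)\<^sup>2)) + \<bar>W i 0\<bar>)
        \<le> 4 / N * (5 * real d + real d)" if "i \<in> {1..Suc d}" for i
    proof (intro mult_mono add_mono 1)
      show "\<bar>w i\<bar> \<le> 4 / N" using N by (auto simp: w_def abs_mult power_abs divide_right_mono)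
      show "\<bar>W i 0\<bar> \<le> real d" using that by (auto simp: W_def)
    qed (use N in \<open>auto intro!: sum_nonneg add_nonneg_nonneg mult_nonneg_nonneg\<close>)
    then have "path_norm3 d (2 * d) (Suc d) \<theta> b W w \<le> (\<Sum>i=1..Suc d. 4 / N * (5 * real d + real d)) + \<bar>w 0\<bar>"
      unfolding path_norm3_def by (intro add_mono sum_mono) auto
    also have "\<dots> = (real (Suc d) * (4 * (5 * real d + real d)) + 1) / N"
      using N by (simp add: w_def add_divide_distrib)
    \<comment> \<open>\<open>N\<close> was chosen for this:
      \<open>(d + 1) * 24 * d + 1\<close>.\<close>
    also have "\<dots> = 1" using N unfolding N_def by (simp add: power2_eq_square algebra_simps)
    finally show ?thesis .
  qed
  then show ?thesis
    unfolding F3L_def N_def[symmetric] eq[symmetric] by blast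
qed

lemma F3L_lower_bound:
  assumes d: "d \<ge> 1"
  shows "ipm (F3L d) (mu d (sd d)) (nu d (sd d)) \<ge> ereal (1 / (513 * (real d)\<^sup>2 + 512 * real d + 1))"
proof -
  let ?N = "24 * (real d)\<^sup>2 + 24 * real d + 1"
  let ?f = "\<lambda>x. parity_net d x / ?N"
  have N: "?N > 0" by (simp add: add_nonneg_pos)
  \<comment> \<open>The gap \<open>1/2\<close> over the norm bound has denominator
    \<open>48 * d\<^sup>2 + 48 * d + 2\<close>, which for \<open>d \<ge> 1\<close> is at most the
    stated one.\<close>
  have "1 / (513 * (real d)\<^sup>2 + 512 * real d + 1) \<le> 1 / (2 * ?N)"
  proof (rule divide_left_mono)
    have "1 \<le> (real d)\<^sup>2" using d by simp
    then show "2 * ?N \<le> 513 * (real d)\<^sup>2 + 512 * real d + 1" by simp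
  qed (use N in \<open>auto intro!: mult_pos_pos add_nonneg_pos\<close>)
  also have "\<dots> = (1 / 2) / ?N" by simp
  also have "\<dots> \<le> (integral\<^sup>L (mu d (sd d)) (parity_net d) - integral\<^sup>L (nu d (sd d)) (parity_net d)) / ?N"
    using N by (intro divide_right_mono parity_net_gap d) auto
  also have "\<dots> \<le> \<bar>integral\<^sup>L (mu d (sd d)) ?f - integral\<^sup>L (nu d (sd d)) ?f\<bar>"
    by (simp add: diff_divide_distrib)
  finally have "ereal (1 / (513 * (real d)\<^sup>2 + 512 * real d + 1))
      \<le> ereal \<bar>integral\<^sup>L (mu d (sd d)) ?f - integral\<^sup>L (nu d (sd d)) ?f\<bar>" by simp
  also have "\<dots> \<le> ipm (F3L d) (mu d (sd d)) (nu d (sd d))"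
    unfolding ipm_def by (rule SUP_upper[OF parity_net_in_F3L[OF d]])
  finally show ?thesis .
qed

theorem theorem4:
  shows "(\<forall>d\<ge>1. \<exists>!s. s > 0 \<and> sd_eq (1/8) (1/8) d s)
    \<and> (\<forall>d\<ge>1. prob_space (mu d (sd d)) \<and> prob_space (nu d (sd d)))
    \<and> 0.7698 \<le> kappa \<and> kappa < 0.7699
    \<and> (\<exists>C::real. C > 0 \<and>
         (\<forall>d\<ge>1. ipm (F2L d) (mu d (sd d)) (nu d (sd d)) \<le> ereal (C * kappa ^ d * (real d)\<^sup>2)))
    \<and> (\<forall>d\<ge>1. ipm (F3L d) (mu d (sd d)) (nu d (sd d))
         \<ge> ereal (1 / (513 * (real d)\<^sup>2 + 512 * real d + 1)))"
proof -
  obtain C :: real where "C > 0"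
    "\<And>d. d \<ge> 1 \<Longrightarrow> ipm (F2L d) (mu d (sd d)) (nu d (sd d)) \<le> ereal (C * kappa ^ d * (real d)\<^sup>2)"
    by (rule F2L_upper_bound) blast
  then show ?thesis
    using sd_ex1 prob_space_mu_nu sd_pos kappa_ge kappa_less F3L_lower_bound by blast
qed

end
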